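(* Let $\mathbf{D}$ be a Boolean dagger kernel category. Then $\mathbf{D}_{kck}$, with dagger $(c,k)^\dagger=(k^\dagger,c^\dagger)$, is again a Boolean dagger kernel category, and the functor $D\colon\mathbf{D}_{kck}\to\mathbf{D}$, $X\mapsto X$, $(c,k)\mapsto k\circ c$, is a morphism of dagger kernel categories such that for each object $X$ the induced map from the poset of kernels with codomain $X$ in $\mathbf{D}_{kck}$ to $\mathrm{KSub}(X)$ in $\mathbf{D}$ is an isomorphism (so the induced map of kernel fibrations is a change-of-base/pullback). Moreover, in $\mathbf{D}_{kck}$ the classes of kernels, dagger monos, monos and zero-monos coincide. Finally, $\mathbf{D}_{kck}$ is universal among such categories: for every Boolean dagger kernel category $\mathbf{E}$ in which every zero-mono is a kernel and every morphism of dagger kernel categories $F\colon\mathbf{E}\to\mathbf{D}$, there is a unique functor $G\colon\mathbf{E}\to\mathbf{D}_{kck}$ with $D\circ G=F$.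
   Context: A dagger category is a category with a contravariant functor $\dagger$ that is the identity on objects with $f^{\dagger\dagger}=f$; $f$ is a dagger mono if $f^\dagger\circ f=\mathrm{id}$. A dagger kernel category is a dagger category with a zero object $0$ in which every morphism $f$ has a kernel (universal $k$ with $f\circ k=0$) that can be chosen to be a dagger mono, denoted $\ker(f)$; kernels are represented by dagger monos, and cokernels (morphisms $\mathrm{coker}(f)=\ker(f^\dagger)^\dagger$) by dagger epis. $\mathrm{KSub}(X)$ is the poset of kernels with codomain $X$ modulo isomorphism of domains, ordered by factorisation; meets $\wedge$ are pullbacks. $\mathbf{D}$ is Boolean if for all kernels $m,n$ with common codomain, $m\wedge n=0$ implies $m^\dagger\circ n=0$. A morphism $m$ is a zero-mono if $m\circ f=0$ implies $f=0$. A morphism of dagger kernel categories is a functor $F$ with $F(f^\dagger)=F(f)^\dagger$, sending the zero object to a zero object and a kernel $k$ of $f$ to a kernel of $F(f)$. The category $\mathbf{D}_{kck}$ has the objects of $\mathbf{D}$; a morphism $X\to Y$ is a pair $(c,k)$ of a cokernel $c\colon X\to M$ and a kernel $k\colon M\to Y$ of $\mathbf{D}$, where $(c,k)$ is identified with $(\varphi\circ c,k\circ\varphi^{-1})$ for isomorphisms $\varphi$. The identity is $(\mathrm{id},\mathrm{id})$. The composite of $(c,k)\colon X\to Y$ (via $M$) and $(d,l)\colon Y\to Z$ (via $N$) is $(q^\dagger\circ c,\,l\circ p)$, where $p\colon P\to N$, $q\colon P\to M$ form the pullback $k\circ q=d^\dagger\circ p$ of the kernels $k$ and $d^\dagger$.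 *)

theory Defs
  imports Main
begin

section \<open>Categories and functors\<close>

text \<open>Categories are small, with carrier sets of objects and of arrows. The composite
  \<open>g \<cdot>\<^bsub>C\<^esub> f\<close> is \<open>f\<close> followed by \<open>g\<close>, and is meaningful only if
  the codomain of \<open>f\<close> is the domain of \<open>g\<close>.\<close>

record ('o, 'a) cat =
  Obj :: "'o set"
  Arr :: "'a set"
  Dom :: "'a \<Rightarrow> 'o"
  Cod :: "'a \<Rightarrow> 'o"
  Id :: "'o \<Rightarrow> 'a"
  Comp :: "'a \<Rightarrow> 'a \<Rightarrow> 'a"  (infixr \<open>\<cdot>\<index>\<close> 70)

record ('o, 'a) dagger_cat = "('o, 'a) cat" +
  Dag :: "'a \<Rightarrow> 'a"  (\<open>_\<dagger>\<index>\<close> [1000] 999)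

definition hom :: "('o, 'a, 'm) cat_scheme \<Rightarrow> 'o \<Rightarrow> 'o \<Rightarrow> 'a set" where
  "hom C X Y = {f \<in> Arr C. Dom C f = X \<and> Cod C f = Y}"

locale category =
  fixes C :: "('o, 'a, 'm) cat_scheme" (structure)
  assumes Dom_Obj: "f \<in> Arr C \<Longrightarrow> Dom C f \<in> Obj C"
    and Cod_Obj: "f \<in> Arr C \<Longrightarrow> Cod C f \<in> Obj C"
    and Id_hom: "X \<in> Obj C \<Longrightarrow> Id C X \<in> hom C X X"
    and Comp_hom: "\<lbrakk>f \<in> hom C X Y; g \<in> hom C Y Z\<rbrakk> \<Longrightarrow> g \<cdot> f \<in> hom C X Z"
    and Comp_Id: "f \<in> hom C X Y \<Longrightarrow> f \<cdot> Id C X = f"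
    and Id_Comp: "f \<in> hom C X Y \<Longrightarrow> Id C Y \<cdot> f = f"
    and Comp_assoc: "\<lbrakk>f \<in> hom C X Y; g \<in> hom C Y Z; h \<in> hom C Z W\<rbrakk>
        \<Longrightarrow> (h \<cdot> g) \<cdot> f = h \<cdot> (g \<cdot> f)"

record ('o, 'a, 'p, 'b) fctr =
  FObj :: "'o \<Rightarrow> 'p"
  FArr :: "'a \<Rightarrow> 'b"

definition is_functor ::
  "('o, 'a, 'm) cat_scheme \<Rightarrow> ('p, 'b, 'n) cat_scheme \<Rightarrow> ('o, 'a, 'p, 'b) fctr \<Rightarrow> bool" where
  "is_functor C D F \<longleftrightarrow> category C \<and> category D
    \<and> (\<forall>X \<in> Obj C. FObj F X \<in> Obj D)
    \<and> (\<forall>f \<in> Arr C. FArr F f \<in> hom D (FObj F (Dom C f)) (FObj F (Cod C f)))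
    \<and> (\<forall>X \<in> Obj C. FArr F (Id C X) = Id D (FObj F X))
    \<and> (\<forall>f \<in> Arr C. \<forall>g \<in> Arr C. Dom C g = Cod C f
         \<longrightarrow> FArr F (g \<cdot>\<^bsub>C\<^esub> f) = FArr F g \<cdot>\<^bsub>D\<^esub> FArr F f)"

text \<open>Only the values on the carriers matter.\<close>

definition functor_eq ::
  "('o, 'a, 'm) cat_scheme \<Rightarrow> ('o, 'a, 'p, 'b) fctr \<Rightarrow> ('o, 'a, 'p, 'b) fctr \<Rightarrow> bool" where
  "functor_eq C F G \<longleftrightarrow>
    (\<forall>X \<in> Obj C. FObj F X = FObj G X) \<and> (\<forall>f \<in> Arr C. FArr F f = FArr G f)"

definition functor_comp ::
  "('p, 'b, 'q, 'c) fctr \<Rightarrow> ('o, 'a, 'p, 'b) fctr \<Rightarrow> ('o, 'a, 'q, 'c) fctr" where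
  "functor_comp G F = \<lparr>FObj = FObj G \<circ> FObj F, FArr = FArr G \<circ> FArr F\<rparr>"

text \<open>A strict pullback square of categories: a commuting square of functors whose comparison
  functor into the fibre product of categories is bijective on objects and on arrows.\<close>

definition cat_pullback_square ::
  "('o, 'a, 'm) cat_scheme \<Rightarrow> ('p, 'b, 'n) cat_scheme \<Rightarrow> ('q, 'c, 'k) cat_scheme
    \<Rightarrow> ('r, 'd, 'l) cat_scheme \<Rightarrow> ('o, 'a, 'p, 'b) fctr \<Rightarrow> ('o, 'a, 'q, 'c) fctr
    \<Rightarrow> ('p, 'b, 'r, 'd) fctr \<Rightarrow> ('q, 'c, 'r, 'd) fctr \<Rightarrow> bool" where
  "cat_pullback_square P A B C p q F G \<longleftrightarrow>
    is_functor P A p \<and> is_functor P B q \<and> is_functor A C F \<and> is_functor B C G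
    \<and> functor_eq P (functor_comp F p) (functor_comp G q)
    \<and> bij_betw (\<lambda>x. (FObj p x, FObj q x)) (Obj P)
        {(a, b). a \<in> Obj A \<and> b \<in> Obj B \<and> FObj F a = FObj G b}
    \<and> bij_betw (\<lambda>x. (FArr p x, FArr q x)) (Arr P)
        {(f, g). f \<in> Arr A \<and> g \<in> Arr B \<and> FArr F f = FArr G g}"

section \<open>Notions inside a category\<close>

definition inverse_arrows :: "('o, 'a, 'm) cat_scheme \<Rightarrow> 'a \<Rightarrow> 'a \<Rightarrow> bool" where
  "inverse_arrows C f g \<longleftrightarrow> f \<in> Arr C \<and> g \<in> hom C (Cod C f) (Dom C f)
    \<and> g \<cdot>\<^bsub>C\<^esub> f = Id C (Dom C f) \<and> f \<cdot>\<^bsub>C\<^esub> g = Id C (Cod C f)"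

definition mono_arr :: "('o, 'a, 'm) cat_scheme \<Rightarrow> 'a \<Rightarrow> bool" where
  "mono_arr C m \<longleftrightarrow> m \<in> Arr C
    \<and> (\<forall>X. \<forall>f \<in> hom C X (Dom C m). \<forall>g \<in> hom C X (Dom C m).
         m \<cdot>\<^bsub>C\<^esub> f = m \<cdot>\<^bsub>C\<^esub> g \<longrightarrow> f = g)"

definition zero_object :: "('o, 'a, 'm) cat_scheme \<Rightarrow> 'o \<Rightarrow> bool" where
  "zero_object C Z \<longleftrightarrow> Z \<in> Obj C
    \<and> (\<forall>X \<in> Obj C. (\<exists>!f. f \<in> hom C X Z) \<and> (\<exists>!f. f \<in> hom C Z X))"

definition zero_arr :: "('o, 'a, 'm) cat_scheme \<Rightarrow> 'a \<Rightarrow> bool" where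
  "zero_arr C f \<longleftrightarrow> f \<in> Arr C
    \<and> (\<exists>Z. zero_object C Z
         \<and> (\<exists>g \<in> hom C (Dom C f) Z. \<exists>h \<in> hom C Z (Cod C f). f = h \<cdot>\<^bsub>C\<^esub> g))"

definition zero_mono :: "('o, 'a, 'm) cat_scheme \<Rightarrow> 'a \<Rightarrow> bool" where
  "zero_mono C m \<longleftrightarrow> m \<in> Arr C
    \<and> (\<forall>f \<in> Arr C. Cod C f = Dom C m \<and> zero_arr C (m \<cdot>\<^bsub>C\<^esub> f) \<longrightarrow> zero_arr C f)"

definition kernel_of :: "('o, 'a, 'm) cat_scheme \<Rightarrow> 'a \<Rightarrow> 'a \<Rightarrow> bool" where
  "kernel_of C k f \<longleftrightarrow> f \<in> Arr C \<and> k \<in> Arr C \<and> Cod C k = Dom C f \<and> zero_arr C (f \<cdot>\<^bsub>C\<^esub> k)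
    \<and> (\<forall>g \<in> Arr C. Cod C g = Dom C f \<and> zero_arr C (f \<cdot>\<^bsub>C\<^esub> g)
         \<longrightarrow> (\<exists>!h. h \<in> hom C (Dom C g) (Dom C k) \<and> k \<cdot>\<^bsub>C\<^esub> h = g))"

text \<open>The square \<open>f \<cdot> p = g \<cdot> q\<close> is a pullback.\<close>

definition is_pullback :: "('o, 'a, 'm) cat_scheme \<Rightarrow> 'a \<Rightarrow> 'a \<Rightarrow> 'a \<Rightarrow> 'a \<Rightarrow> bool" where
  "is_pullback C f g p q \<longleftrightarrow> f \<in> Arr C \<and> g \<in> Arr C \<and> Cod C f = Cod C g
    \<and> p \<in> Arr C \<and> q \<in> hom C (Dom C p) (Dom C g) \<and> Cod C p = Dom C f
    \<and> f \<cdot>\<^bsub>C\<^esub> p = g \<cdot>\<^bsub>C\<^esub> q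
    \<and> (\<forall>X. \<forall>a \<in> hom C X (Dom C f). \<forall>b \<in> hom C X (Dom C g). f \<cdot>\<^bsub>C\<^esub> a = g \<cdot>\<^bsub>C\<^esub> b
         \<longrightarrow> (\<exists>!h. h \<in> hom C X (Dom C p) \<and> p \<cdot>\<^bsub>C\<^esub> h = a \<and> q \<cdot>\<^bsub>C\<^esub> h = b))"

section \<open>Dagger kernel categories\<close>

locale dagger_category = category C
  for C :: "('o, 'a, 'm) dagger_cat_scheme" (structure) +
  assumes Dag_hom: "f \<in> hom C X Y \<Longrightarrow> f\<dagger> \<in> hom C Y X"
    and Dag_Id: "X \<in> Obj C \<Longrightarrow> (Id C X)\<dagger> = Id C X"
    and Dag_Comp: "\<lbrakk>f \<in> hom C X Y; g \<in> hom C Y Z\<rbrakk> \<Longrightarrow> (g \<cdot> f)\<dagger> = f\<dagger> \<cdot> g\<dagger>"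
    and Dag_Dag: "f \<in> Arr C \<Longrightarrow> (f\<dagger>)\<dagger> = f"

definition dagger_mono :: "('o, 'a, 'm) dagger_cat_scheme \<Rightarrow> 'a \<Rightarrow> bool" where
  "dagger_mono C f \<longleftrightarrow> f \<in> Arr C \<and> f\<dagger>\<^bsub>C\<^esub> \<cdot>\<^bsub>C\<^esub> f = Id C (Dom C f)"

text \<open>Kernels are always represented by dagger monos, and dually for cokernels.\<close>

definition is_kernel :: "('o, 'a, 'm) dagger_cat_scheme \<Rightarrow> 'a \<Rightarrow> bool" where
  "is_kernel C k \<longleftrightarrow> dagger_mono C k \<and> (\<exists>f. kernel_of C k f)"

definition is_cokernel :: "('o, 'a, 'm) dagger_cat_scheme \<Rightarrow> 'a \<Rightarrow> bool" where
  "is_cokernel C c \<longleftrightarrow> c \<in> Arr C \<and> is_kernel C (c\<dagger>\<^bsub>C\<^esub>)"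

locale dagger_kernel_category = dagger_category C
  for C :: "('o, 'a, 'm) dagger_cat_scheme" (structure) +
  assumes ex_zero_object: "\<exists>Z. zero_object C Z"
    and ex_kernel: "f \<in> Arr C \<Longrightarrow> \<exists>k. kernel_of C k f \<and> dagger_mono C k"

text \<open>The meet of the kernels \<open>m\<close> and \<open>n\<close> is the diagonal \<open>m \<cdot> p\<close> of their pullback. It is the
  bottom of the poset of kernels precisely if it is a zero arrow.\<close>

locale boolean_dagger_kernel_category = dagger_kernel_category C
  for C :: "('o, 'a, 'm) dagger_cat_scheme" (structure) +
  assumes boolean: "\<lbrakk>is_kernel C m; is_kernel C n; Cod C m = Cod C n;
      is_pullback C m n p q; zero_arr C (m \<cdot> p)\<rbrakk> \<Longrightarrow> zero_arr C (m\<dagger> \<cdot> n)"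

definition dagger_kernel_morphism ::
  "('o, 'a, 'm) dagger_cat_scheme \<Rightarrow> ('p, 'b, 'n) dagger_cat_scheme
    \<Rightarrow> ('o, 'a, 'p, 'b) fctr \<Rightarrow> bool" where
  "dagger_kernel_morphism C D F \<longleftrightarrow>
    dagger_kernel_category C \<and> dagger_kernel_category D \<and> is_functor C D F
    \<and> (\<forall>f \<in> Arr C. FArr F (f\<dagger>\<^bsub>C\<^esub>) = (FArr F f)\<dagger>\<^bsub>D\<^esub>)
    \<and> (\<forall>Z. zero_object C Z \<longrightarrow> zero_object D (FObj F Z))
    \<and> (\<forall>f k. kernel_of C k f \<longrightarrow> kernel_of D (FArr F k) (FArr F f))"

section \<open>The poset of kernels and the kernel fibration\<close>

definition ksub_class :: "('o, 'a, 'm) dagger_cat_scheme \<Rightarrow> 'a \<Rightarrow> 'a set" where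
  "ksub_class C m = {n. is_kernel C n \<and>
    (\<exists>\<phi> \<psi>. inverse_arrows C \<phi> \<psi> \<and> \<phi> \<in> hom C (Dom C n) (Dom C m) \<and> n = m \<cdot>\<^bsub>C\<^esub> \<phi>)}"

definition KSub :: "('o, 'a, 'm) dagger_cat_scheme \<Rightarrow> 'o \<Rightarrow> 'a set set" where
  "KSub C X = ksub_class C ` {m. is_kernel C m \<and> Cod C m = X}"

definition ksub_le :: "('o, 'a, 'm) dagger_cat_scheme \<Rightarrow> 'a set \<Rightarrow> 'a set \<Rightarrow> bool" where
  "ksub_le C A B \<longleftrightarrow>
    (\<exists>m \<in> A. \<exists>n \<in> B. \<exists>h \<in> hom C (Dom C m) (Dom C n). m = n \<cdot>\<^bsub>C\<^esub> h)"

text \<open>The map of kernel posets \<open>[m] \<mapsto> [F m]\<close> induced by \<open>F : C \<rightarrow> D\<close>.\<close>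

definition ksub_map ::
  "('p, 'b, 'n) dagger_cat_scheme \<Rightarrow> ('o, 'a, 'p, 'b) fctr \<Rightarrow> 'a set \<Rightarrow> 'b set" where
  "ksub_map D F A = (\<Union>m \<in> A. ksub_class D (FArr F m))"

definition order_iso ::
  "'a set \<Rightarrow> ('a \<Rightarrow> 'a \<Rightarrow> bool) \<Rightarrow> 'b set \<Rightarrow> ('b \<Rightarrow> 'b \<Rightarrow> bool) \<Rightarrow> ('a \<Rightarrow> 'b) \<Rightarrow> bool" where
  "order_iso A le B le' f \<longleftrightarrow>
    bij_betw f A B \<and> (\<forall>x \<in> A. \<forall>y \<in> A. le x y \<longleftrightarrow> le' (f x) (f y))"

text \<open>The total category of the kernel fibration: objects are kernels \<open>[m]\<close> on \<open>X\<close>, and an arrow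
  from \<open>[m]\<close> on \<open>X\<close> to \<open>[n]\<close> on \<open>Y\<close> is an arrow \<open>f : X \<rightarrow> Y\<close> for which \<open>f \<cdot> m\<close> factors
  through \<open>n\<close>. The projection to the base is the fibration.\<close>

definition kernel_fibration ::
  "('o, 'a, 'm) dagger_cat_scheme
    \<Rightarrow> ('o \<times> 'a set, ('o \<times> 'a set) \<times> 'a \<times> ('o \<times> 'a set)) cat" where
  "kernel_fibration C = \<lparr>
    Obj = {(X, A). X \<in> Obj C \<and> A \<in> KSub C X},
    Arr = {((X, A), f, (Y, B)). A \<in> KSub C X \<and> B \<in> KSub C Y \<and> f \<in> hom C X Y
      \<and> (\<exists>m \<in> A. \<exists>n \<in> B. \<exists>h \<in> hom C (Dom C m) (Dom C n). f \<cdot>\<^bsub>C\<^esub> m = n \<cdot>\<^bsub>C\<^esub> h)},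
    Dom = (\<lambda>(a, f, b). a),
    Cod = (\<lambda>(a, f, b). b),
    Id = (\<lambda>a. (a, Id C (fst a), a)),
    Comp = (\<lambda>(b, g, c) (a, f, b'). (a, g \<cdot>\<^bsub>C\<^esub> f, c))\<rparr>"

definition kernel_fibration_proj ::
  "('o \<times> 'a set, ('o \<times> 'a set) \<times> 'a \<times> ('o \<times> 'a set), 'o, 'a) fctr" where
  "kernel_fibration_proj = \<lparr>FObj = fst, FArr = (\<lambda>(a, f, b). f)\<rparr>"

definition kernel_fibration_map ::
  "('p, 'b, 'n) dagger_cat_scheme \<Rightarrow> ('o, 'a, 'p, 'b) fctr
    \<Rightarrow> ('o \<times> 'a set, ('o \<times> 'a set) \<times> 'a \<times> ('o \<times> 'a set),
        'p \<times> 'b set, ('p \<times> 'b set) \<times> 'b \<times> ('p \<times> 'b set)) fctr" where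
  "kernel_fibration_map D F =
    (let obj = (\<lambda>(X, A). (FObj F X, ksub_map D F A))
     in \<lparr>FObj = obj, FArr = (\<lambda>(a, f, b). (obj a, FArr F f, obj b))\<rparr>)"

section \<open>The category of cokernel-kernel pairs\<close>

definition kck_pair :: "('o, 'a, 'm) dagger_cat_scheme \<Rightarrow> 'a \<Rightarrow> 'a \<Rightarrow> bool" where
  "kck_pair C c k \<longleftrightarrow> is_cokernel C c \<and> is_kernel C k \<and> Cod C c = Dom C k"

definition kck_class :: "('o, 'a, 'm) dagger_cat_scheme \<Rightarrow> 'a \<Rightarrow> 'a \<Rightarrow> ('a \<times> 'a) set" where
  "kck_class C c k = {(c', k'). kck_pair C c' k' \<and>
    (\<exists>\<phi> \<psi>. inverse_arrows C \<phi> \<psi> \<and> Dom C \<phi> = Cod C c \<and> c' = \<phi> \<cdot>\<^bsub>C\<^esub> c \<and> k' = k \<cdot>\<^bsub>C\<^esub> \<psi>)}"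

text \<open>Arrows are equivalence classes of pairs. Domain and codomain are those common to all
  representatives. The composite collects the classes obtained from all choices of
  representatives and of pullback; these classes are equal. The legs \<open>p\<close>, \<open>q\<close> are required to be
  kernels, hence dagger mono: for an arbitrary representative of the pullback, \<open>q\<dagger> \<cdot> c\<close> need
  not be dagger epi.\<close>

definition kck :: "('o, 'a, 'm) dagger_cat_scheme \<Rightarrow> ('o, ('a \<times> 'a) set) dagger_cat" where
  "kck C = \<lparr>
    Obj = Obj C,
    Arr = {kck_class C c k | c k. kck_pair C c k},
    Dom = (\<lambda>S. the_elem ((\<lambda>(c, k). Dom C c) ` S)),
    Cod = (\<lambda>S. the_elem ((\<lambda>(c, k). Cod C k) ` S)),
    Id = (\<lambda>X. kck_class C (Id C X) (Id C X)),
    Comp = (\<lambda>T S. \<Union>{kck_class C (q\<dagger>\<^bsub>C\<^esub> \<cdot>\<^bsub>C\<^esub> c) (l \<cdot>\<^bsub>C\<^esub> p) | c k d l p q.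
      (c, k) \<in> S \<and> (d, l) \<in> T \<and> is_pullback C k (d\<dagger>\<^bsub>C\<^esub>) q p \<and> is_kernel C p \<and> is_kernel C q}),
    Dag = (\<lambda>S. (\<lambda>(c, k). (k\<dagger>\<^bsub>C\<^esub>, c\<dagger>\<^bsub>C\<^esub>)) ` S)\<rparr>"

definition kck_functor ::
  "('o, 'a, 'm) dagger_cat_scheme \<Rightarrow> ('o, ('a \<times> 'a) set, 'o, 'a) fctr" where
  "kck_functor C = \<lparr>
    FObj = (\<lambda>X. X),
    FArr = (\<lambda>S. the_elem ((\<lambda>(c, k). k \<cdot>\<^bsub>C\<^esub> c) ` S))\<rparr>"

end

theory Submission
  imports Defs
begin

text \<open>Write \<open>k \<cdot> c\<close> for the arrow of the base underlying a pair \<open>(c, k)\<close>. Since \<open>c\<close> is dagger epi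
  and \<open>k\<close> dagger mono, an arrow has at most one such factorisation up to isomorphism, so the
  category of pairs is a wide subcategory of the base. Closure under composition is where
  Booleanness enters: for kernels \<open>m\<close>, \<open>n\<close> with pullback \<open>m \<cdot> p = n \<cdot> q\<close> one has
  \<open>m\<dagger> \<cdot> n = p \<cdot> q\<dagger>\<close>. The subcategory contains all kernels, and every wide dagger subcategory with
  this property inherits zero objects, kernels, Booleanness and the posets of kernels. A zero-mono
  \<open>k \<cdot> c\<close> has a unitary \<open>c\<close>, so it is a kernel. If all zero-monos of a dagger kernel category are
  kernels, then every arrow \<open>f\<close> has the form \<open>k \<cdot> c\<close>, with \<open>c\<close> the coimage of \<open>f\<close>; a morphism of
  dagger kernel categories preserves this factorisation and therefore lands in the subcategory.\<close>

declare hom_def [simp]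

section \<open>Factorisations and zero arrows\<close>

definition factors_through :: "('o, 'a, 'm) cat_scheme \<Rightarrow> 'a \<Rightarrow> 'a \<Rightarrow> bool" where
  "factors_through C g k \<longleftrightarrow> (\<exists>h \<in> hom C (Dom C g) (Dom C k). k \<cdot>\<^bsub>C\<^esub> h = g)"

context category
begin

lemmas [simp] = Dom_Obj Cod_Obj

lemma Id_simps [simp]:
  assumes "X \<in> Obj C"
  shows "Id C X \<in> Arr C" "Dom C (Id C X) = X" "Cod C (Id C X) = X"
  using Id_hom[OF assms] by auto

lemma Comp_simps [simp]:
  assumes "f \<in> Arr C" "g \<in> Arr C" "Dom C g = Cod C f"
  shows "g \<cdot> f \<in> Arr C" "Dom C (g \<cdot> f) = Dom C f" "Cod C (g \<cdot> f) = Cod C g"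
  using Comp_hom[of f "Dom C f" "Cod C f" g "Cod C g"] assms by auto

lemma Comp_Id_left [simp]: "f \<in> Arr C \<Longrightarrow> X = Cod C f \<Longrightarrow> Id C X \<cdot> f = f"
  and Comp_Id_right [simp]: "f \<in> Arr C \<Longrightarrow> X = Dom C f \<Longrightarrow> f \<cdot> Id C X = f"
  using Id_Comp Comp_Id by auto

lemma assoc [simp]:
  assumes "f \<in> Arr C" "g \<in> Arr C" "h \<in> Arr C" "Dom C g = Cod C f" "Dom C h = Cod C g"
  shows "(h \<cdot> g) \<cdot> f = h \<cdot> (g \<cdot> f)"
  using assms Comp_assoc by auto

lemma factors_throughI:
  assumes "k \<cdot> h = g" "k \<in> Arr C" "h \<in> Arr C" "Cod C h = Dom C k"
  shows "factors_through C g k"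
  using assms by (auto simp: factors_through_def)

lemma factors_throughE:
  assumes "factors_through C g k"
  obtains h where "h \<in> Arr C" "Dom C h = Dom C g" "Cod C h = Dom C k" "k \<cdot> h = g"
  using assms by (auto simp: factors_through_def)

lemma factors_through_Cod: "factors_through C g k \<Longrightarrow> k \<in> Arr C \<Longrightarrow> Cod C g = Cod C k"
  by (auto elim!: factors_throughE)

lemma factors_through_refl: "k \<in> Arr C \<Longrightarrow> factors_through C k k"
  by (rule factors_throughI[where h = "Id C (Dom C k)"]) auto

lemma factors_through_Comp_right:
  assumes "factors_through C g k" "k \<in> Arr C" "x \<in> Arr C" "Cod C x = Dom C g"
  shows "factors_through C (g \<cdot> x) k"
  using assms(1)
proof (rule factors_throughE)
  fix h assume "h \<in> Arr C" "Dom C h = Dom C g" "Cod C h = Dom C k" "k \<cdot> h = g"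
  then show ?thesis
    using assms by (intro factors_throughI[where h = "h \<cdot> x"]) auto
qed

lemma factors_through_Comp_left:
  assumes "factors_through C g k" "k \<in> Arr C" "f \<in> Arr C" "Dom C f = Cod C k"
  shows "factors_through C (f \<cdot> g) (f \<cdot> k)"
  using assms(1)
proof (rule factors_throughE)
  fix h assume "h \<in> Arr C" "Dom C h = Dom C g" "Cod C h = Dom C k" "k \<cdot> h = g"
  then show ?thesis
    using assms by (intro factors_throughI[where h = h]) auto
qed

lemma factors_through_trans:
  assumes "factors_through C f g" "factors_through C g k" "k \<in> Arr C"
  shows "factors_through C f k"
  using assms(1)
proof (rule factors_throughE)
  fix h assume "h \<in> Arr C" "Cod C h = Dom C g" "g \<cdot> h = f"
  then show ?thesis
    using factors_through_Comp_right[OF assms(2,3), of h] by simp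
qed

lemma mono_arr_Arr: "mono_arr C m \<Longrightarrow> m \<in> Arr C"
  by (simp add: mono_arr_def)

lemma mono_arr_cancel:
  assumes "mono_arr C m" "m \<cdot> a = m \<cdot> b"
    and "a \<in> Arr C" "b \<in> Arr C" "Cod C a = Dom C m" "Cod C b = Dom C m" "Dom C a = Dom C b"
  shows "a = b"
  using assms by (auto simp: mono_arr_def)

lemma mono_arr_Comp_iso:
  assumes "mono_arr C m" "inverse_arrows C \<phi> \<psi>" "Cod C \<phi> = Dom C m"
  shows "mono_arr C (m \<cdot> \<phi>)"
proof -
  note mono_arr_Arr[OF assms(1), simp]
  have [simp]: "\<phi> \<in> Arr C" "\<psi> \<in> Arr C" "Dom C \<psi> = Dom C m" "Cod C \<psi> = Dom C \<phi>"
    and inverse: "\<psi> \<cdot> \<phi> = Id C (Dom C \<phi>)"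
    using assms(2,3) by (auto simp: inverse_arrows_def)
  have "a = b" if [simp]: "a \<in> Arr C" "b \<in> Arr C" "Cod C a = Dom C \<phi>" "Cod C b = Dom C \<phi>"
    "Dom C a = Dom C b" and "m \<cdot> (\<phi> \<cdot> a) = m \<cdot> (\<phi> \<cdot> b)" for a b
  proof -
    have "\<phi> \<cdot> a = \<phi> \<cdot> b"
      by (rule mono_arr_cancel[OF assms(1)]) (use that assms(3) in simp_all)
    then have "(\<psi> \<cdot> \<phi>) \<cdot> a = (\<psi> \<cdot> \<phi>) \<cdot> b"
      using assms(3) by simp
    then show ?thesis
      unfolding inverse by simp
  qed
  then show ?thesis
    using assms(3) by (auto simp: mono_arr_def)
qed

lemma mono_arrs_isoE:
  assumes m: "mono_arr C m" and n: "mono_arr C n"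
    and "factors_through C m n" "factors_through C n m"
  obtains \<phi> \<psi> where "inverse_arrows C \<phi> \<psi>" "\<phi> \<in> hom C (Dom C m) (Dom C n)" "n \<cdot> \<phi> = m"
proof -
  note mono_arr_Arr[OF m, simp] mono_arr_Arr[OF n, simp]
  obtain \<phi> where \<phi>: "\<phi> \<in> Arr C" "Dom C \<phi> = Dom C m" "Cod C \<phi> = Dom C n" "n \<cdot> \<phi> = m"
    using assms(3) by (rule factors_throughE)
  obtain \<psi> where \<psi>: "\<psi> \<in> Arr C" "Dom C \<psi> = Dom C n" "Cod C \<psi> = Dom C m" "m \<cdot> \<psi> = n"
    using assms(4) by (rule factors_throughE)
  have "m \<cdot> (\<psi> \<cdot> \<phi>) = (m \<cdot> \<psi>) \<cdot> \<phi>" "n \<cdot> (\<phi> \<cdot> \<psi>) = (n \<cdot> \<phi>) \<cdot> \<psi>"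
    using \<phi>(1-3) \<psi>(1-3) by simp_all
  then have "m \<cdot> (\<psi> \<cdot> \<phi>) = m \<cdot> Id C (Dom C m)" "n \<cdot> (\<phi> \<cdot> \<psi>) = n \<cdot> Id C (Dom C n)"
    unfolding \<phi>(4) \<psi>(4) by simp_all
  then have "\<psi> \<cdot> \<phi> = Id C (Dom C m)" "\<phi> \<cdot> \<psi> = Id C (Dom C n)"
    using \<phi>(1-3) \<psi>(1-3) by (auto intro: mono_arr_cancel[OF m] mono_arr_cancel[OF n])
  then show thesis
    using that[of \<phi> \<psi>] \<phi> \<psi> by (simp add: inverse_arrows_def)
qed

lemma is_pullback_factors_through:
  assumes "is_pullback C f g p q" "factors_through C h f" "factors_through C h g"
  shows "factors_through C h (f \<cdot> p)"
proof -
  have square: "f \<in> Arr C" "p \<in> Arr C" "Cod C p = Dom C f"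
    using assms(1) by (auto simp: is_pullback_def)
  obtain a where "a \<in> Arr C" "Dom C a = Dom C h" "Cod C a = Dom C f" "f \<cdot> a = h"
    using assms(2) by (rule factors_throughE)
  moreover obtain b where "b \<in> Arr C" "Dom C b = Dom C h" "Cod C b = Dom C g" "g \<cdot> b = h"
    using assms(3) by (rule factors_throughE)
  ultimately have "a \<in> hom C (Dom C h) (Dom C f)" "b \<in> hom C (Dom C h) (Dom C g)"
    "f \<cdot> a = g \<cdot> b"
    by simp_all
  then obtain t where "t \<in> hom C (Dom C h) (Dom C p)" "p \<cdot> t = a"
    using assms(1) unfolding is_pullback_def by blast
  with \<open>f \<cdot> a = h\<close> square show ?thesis
    by (intro factors_throughI[where h = t]) auto
qed

lemma is_pullbackI_mono:
  assumes n: "mono_arr C n" and p: "mono_arr C p"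
    and f: "f \<in> Arr C" "Cod C f = Cod C n" "Cod C p = Dom C f"
    and q: "q \<in> Arr C" "Cod C q = Dom C n" "Dom C q = Dom C p"
    and square: "f \<cdot> p = n \<cdot> q"
    and factors: "\<And>a. \<lbrakk>a \<in> Arr C; Cod C a = Dom C f; factors_through C (f \<cdot> a) n\<rbrakk>
      \<Longrightarrow> factors_through C a p"
  shows "is_pullback C f n p q"
proof -
  note [simp] = mono_arr_Arr[OF n] mono_arr_Arr[OF p] f q
  have "\<exists>!h. h \<in> hom C X (Dom C p) \<and> p \<cdot> h = a \<and> q \<cdot> h = b"
    if ab: "a \<in> hom C X (Dom C f)" "b \<in> hom C X (Dom C n)" "f \<cdot> a = n \<cdot> b" for X a b
  proof -
    have "factors_through C (f \<cdot> a) n"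
      using ab factors_throughI[of n b] by simp
    then have "factors_through C a p"
      using ab(1) factors by simp
    then obtain h where h: "h \<in> hom C X (Dom C p)" "p \<cdot> h = a"
      using ab(1) by (auto elim: factors_throughE)
    have "n \<cdot> (q \<cdot> h) = (f \<cdot> p) \<cdot> h"
      unfolding square using h by simp
    then have "n \<cdot> (q \<cdot> h) = n \<cdot> b"
      using h ab(3) by simp
    then have "q \<cdot> h = b"
      by (rule mono_arr_cancel[OF n]) (use h ab in simp_all)
    then show ?thesis
      using h mono_arr_cancel[OF p] by (intro ex1I[of _ h]) auto
  qed
  then show ?thesis
    using square by (auto simp: is_pullback_def)
qed

lemma zero_object_Obj: "zero_object C Z \<Longrightarrow> Z \<in> Obj C"
  by (simp add: zero_object_def)

lemma zero_object_homE:
  assumes "zero_object C Z" "X \<in> Obj C"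
  obtains a b where "a \<in> hom C X Z" "b \<in> hom C Z X"
  using assms unfolding zero_object_def by blast

lemma zero_object_hom_unique:
  assumes "zero_object C Z" "Dom C f = Z \<or> Cod C f = Z"
    and "f \<in> Arr C" "g \<in> Arr C" "Dom C f = Dom C g" "Cod C f = Cod C g"
  shows "f = g"
proof -
  have "Dom C f \<in> Obj C" "Cod C f \<in> Obj C"
    using assms(3) by auto
  then have "\<exists>!h. h \<in> hom C (Dom C f) (Cod C f)"
    using assms(1,2) unfolding zero_object_def by blast
  then show ?thesis
    using assms(3-) by auto
qed

lemma zero_arrI:
  assumes "zero_object C Z" "a \<in> hom C X Z" "b \<in> hom C Z Y"
  shows "zero_arr C (b \<cdot> a)"
  using assms by (auto simp: zero_arr_def)

lemma zero_arr_Arr: "zero_arr C f \<Longrightarrow> f \<in> Arr C"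
  by (simp add: zero_arr_def)

lemma zero_arrE:
  assumes "zero_arr C f"
  obtains Z a b where "zero_object C Z" "a \<in> hom C (Dom C f) Z" "b \<in> hom C Z (Cod C f)"
    "b \<cdot> a = f"
  using assms unfolding zero_arr_def by blast

lemma zero_arr_throughE:
  assumes "zero_arr C f" and Z: "zero_object C Z"
  obtains a b where "a \<in> hom C (Dom C f) Z" "b \<in> hom C Z (Cod C f)" "b \<cdot> a = f"
  using assms(1)
proof (rule zero_arrE)
  fix W a b
  assume W: "zero_object C W"
    and ab: "a \<in> hom C (Dom C f) W" "b \<in> hom C W (Cod C f)" "b \<cdot> a = f"
  obtain s t where st: "s \<in> hom C W Z" "t \<in> hom C Z W"
    using zero_object_homE[OF Z zero_object_Obj[OF W]] .
  have "t \<cdot> s = Id C W"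
    using st zero_object_Obj[OF W] by (intro zero_object_hom_unique[OF W]) auto
  have "(b \<cdot> t) \<cdot> (s \<cdot> a) = b \<cdot> ((t \<cdot> s) \<cdot> a)"
    using ab st by simp
  also have "\<dots> = f"
    unfolding \<open>t \<cdot> s = Id C W\<close> using ab by simp
  finally show thesis
    using that[of "s \<cdot> a" "b \<cdot> t"] ab st by simp
qed

lemma zero_arr_Comp_left:
  assumes "zero_arr C f" "g \<in> Arr C" "Dom C g = Cod C f"
  shows "zero_arr C (g \<cdot> f)"
  using assms(1)
proof (rule zero_arrE)
  fix Z a b
  assume "zero_object C Z" "a \<in> hom C (Dom C f) Z" "b \<in> hom C Z (Cod C f)" "b \<cdot> a = f"
  then show ?thesis
    using zero_arrI[of Z a _ "g \<cdot> b"] assms by simp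
qed

lemma zero_arr_Comp_right:
  assumes "zero_arr C f" "g \<in> Arr C" "Dom C f = Cod C g"
  shows "zero_arr C (f \<cdot> g)"
  using assms(1)
proof (rule zero_arrE)
  fix Z a b
  assume zero: "zero_object C Z" "a \<in> hom C (Dom C f) Z" "b \<in> hom C Z (Cod C f)" "b \<cdot> a = f"
  then have "zero_arr C (b \<cdot> (a \<cdot> g))"
    using zero_arrI[of Z "a \<cdot> g" _ b] assms by simp
  moreover have "(b \<cdot> a) \<cdot> g = b \<cdot> (a \<cdot> g)"
    using zero(2,3) assms by simp
  ultimately show ?thesis
    using zero(4) by simp
qed

lemma zero_arr_factors_through:
  assumes "factors_through C g f" "zero_arr C f"
  shows "zero_arr C g"
  using assms by (auto elim!: factors_throughE intro: zero_arr_Comp_right)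

lemma zero_arr_unique:
  assumes "zero_arr C f" "zero_arr C g" "Dom C f = Dom C g" "Cod C f = Cod C g"
  shows "f = g"
proof -
  obtain Z where Z: "zero_object C Z"
    using assms(1) unfolding zero_arr_def by blast
  obtain a b where f: "a \<in> hom C (Dom C f) Z" "b \<in> hom C Z (Cod C f)" "b \<cdot> a = f"
    using assms(1) Z by (rule zero_arr_throughE)
  obtain a' b' where g: "a' \<in> hom C (Dom C g) Z" "b' \<in> hom C Z (Cod C g)" "b' \<cdot> a' = g"
    using assms(2) Z by (rule zero_arr_throughE)
  have "a = a'" "b = b'"
    using f(1,2) g(1,2) assms(3,4) by (auto intro: zero_object_hom_unique[OF Z])
  then show ?thesis
    using f(3) g(3) by simp
qed

lemma zero_arr_to_zero_object:
  assumes "zero_object C Z" "f \<in> Arr C" "Cod C f = Z"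
  shows "zero_arr C f"
  using zero_arrI[of Z f _ "Id C Z"] zero_object_Obj[of Z] assms by simp

lemma zero_arr_from_zero_object:
  assumes "zero_object C Z" "f \<in> Arr C" "Dom C f = Z"
  shows "zero_arr C f"
  using zero_arrI[of Z "Id C Z" _ f] zero_object_Obj[of Z] assms by simp

lemma zero_object_iff_zero_arr_Id:
  assumes Z: "Z \<in> Obj C"
  shows "zero_object C Z \<longleftrightarrow> zero_arr C (Id C Z)"
proof
  assume "zero_object C Z"
  then show "zero_arr C (Id C Z)"
    using Z by (intro zero_arr_to_zero_object) auto
next
  assume zero_Id: "zero_arr C (Id C Z)"
  then obtain W a b where W: "zero_object C W" and ab: "a \<in> hom C Z W" "b \<in> hom C W Z"
    using Z by (auto elim!: zero_arrE)
  have zero: "zero_arr C f" if "f \<in> Arr C" "Cod C f = Z \<or> Dom C f = Z" for f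
    using zero_arr_Comp_left[OF zero_Id, of f] zero_arr_Comp_right[OF zero_Id, of f] Z that by auto
  have "(\<exists>!f. f \<in> hom C X Z) \<and> (\<exists>!f. f \<in> hom C Z X)" if X: "X \<in> Obj C" for X
  proof -
    obtain u v where "u \<in> hom C X W" "v \<in> hom C W X"
      using zero_object_homE[OF W X] .
    then have "b \<cdot> u \<in> hom C X Z" "v \<cdot> a \<in> hom C Z X"
      using ab by auto
    moreover have "f = g" if "f \<in> hom C X Z \<and> g \<in> hom C X Z \<or> f \<in> hom C Z X \<and> g \<in> hom C Z X" for f g
      using that zero[of f] zero[of g] by (intro zero_arr_unique) auto
    ultimately show ?thesis by blast
  qed
  then show "zero_object C Z"
    using Z by (auto simp: zero_object_def)
qed

lemma kernel_of_iff:
  "kernel_of C k f \<longleftrightarrow> f \<in> Arr C \<and> mono_arr C k \<and> Cod C k = Dom C f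
    \<and> (\<forall>g \<in> Arr C. Cod C g = Dom C f \<longrightarrow> zero_arr C (f \<cdot> g) = factors_through C g k)"
  (is "_ \<longleftrightarrow> _ \<and> _ \<and> _ \<and> ?universal")
proof
  assume kernel: "kernel_of C k f"
  then have k [simp]: "f \<in> Arr C" "k \<in> Arr C" "Cod C k = Dom C f" and zero: "zero_arr C (f \<cdot> k)"
    and unique: "\<And>g. \<lbrakk>g \<in> Arr C; Cod C g = Dom C f; zero_arr C (f \<cdot> g)\<rbrakk>
      \<Longrightarrow> \<exists>!h. h \<in> hom C (Dom C g) (Dom C k) \<and> k \<cdot> h = g"
    unfolding kernel_of_def by blast+
  have zero_Comp: "zero_arr C (f \<cdot> (k \<cdot> h))" if "h \<in> Arr C" "Cod C h = Dom C k" for h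
    using zero_arr_Comp_right[OF zero, of h] that by simp
  have "a = b" if "a \<in> hom C X (Dom C k)" "b \<in> hom C X (Dom C k)" "k \<cdot> a = k \<cdot> b" for X a b
    using that unique[of "k \<cdot> a"] zero_Comp[of a] by auto
  then have "mono_arr C k"
    by (auto simp: mono_arr_def)
  moreover have ?universal
    using unique zero_Comp by (auto simp: factors_through_def) metis
  ultimately show "f \<in> Arr C \<and> mono_arr C k \<and> Cod C k = Dom C f \<and> ?universal"
    by simp
next
  assume kernel: "f \<in> Arr C \<and> mono_arr C k \<and> Cod C k = Dom C f \<and> ?universal"
  then have k: "k \<in> Arr C"
    using mono_arr_Arr by blast
  have "\<exists>!h. h \<in> hom C (Dom C g) (Dom C k) \<and> k \<cdot> h = g"
    if "g \<in> Arr C" "Cod C g = Dom C f" "zero_arr C (f \<cdot> g)" for g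
    using that kernel mono_arr_cancel[of k] by (auto simp: factors_through_def)
  moreover have "zero_arr C (f \<cdot> k)"
    using kernel k factors_through_refl[OF k] by simp
  ultimately show "kernel_of C k f"
    using kernel k unfolding kernel_of_def by blast
qed

lemma kernel_ofD:
  assumes "kernel_of C k f"
  shows "f \<in> Arr C" "k \<in> Arr C" "Cod C k = Dom C f" "zero_arr C (f \<cdot> k)" "mono_arr C k"
  using assms kernel_of_iff[of k f] unfolding kernel_of_def by blast+

lemma kernel_of_factors_through_iff:
  assumes "kernel_of C k f" "g \<in> Arr C" "Cod C g = Dom C f"
  shows "zero_arr C (f \<cdot> g) \<longleftrightarrow> factors_through C g k"
  using assms by (simp add: kernel_of_iff)

lemma kernel_of_Comp_iso:
  assumes "kernel_of C k f" "inverse_arrows C \<phi> \<psi>" "Cod C \<phi> = Dom C k"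
  shows "kernel_of C (k \<cdot> \<phi>) f"
proof -
  note [simp] = kernel_ofD[OF assms(1)]
  have [simp]: "\<phi> \<in> Arr C" "\<psi> \<in> Arr C" "Dom C \<psi> = Dom C k" "Cod C \<psi> = Dom C \<phi>"
    and inverse: "\<phi> \<cdot> \<psi> = Id C (Dom C k)"
    using assms(2,3) by (auto simp: inverse_arrows_def)
  have "factors_through C (k \<cdot> \<phi>) k" "factors_through C k (k \<cdot> \<phi>)"
    using assms(3) inverse
    by (auto intro: factors_throughI[where h = \<phi>] factors_throughI[where h = \<psi>])
  then have "factors_through C g (k \<cdot> \<phi>) \<longleftrightarrow> factors_through C g k" for g
    using factors_through_trans[of g] assms(3) by auto
  then show ?thesis
    using assms(1,3) mono_arr_Comp_iso[OF kernel_ofD(5)[OF assms(1)] assms(2,3)]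
    by (simp add: kernel_of_iff)
qed

lemma kernel_of_isoE:
  assumes "kernel_of C k f" "kernel_of C l f"
  obtains \<phi> \<psi> where "inverse_arrows C \<phi> \<psi>" "\<phi> \<in> hom C (Dom C k) (Dom C l)" "l \<cdot> \<phi> = k"
proof (rule mono_arrs_isoE)
  show "mono_arr C k" "mono_arr C l"
    using assms kernel_ofD(5) by blast+
  show "factors_through C k l" "factors_through C l k"
    using assms kernel_ofD kernel_of_factors_through_iff by metis+
qed (rule that)

end

section \<open>Dagger kernel categories\<close>

context dagger_category
begin

lemmas [simp] = Dag_Id

lemma Dag_simps [simp]:
  assumes "f \<in> Arr C"
  shows "f\<dagger> \<in> Arr C" "Dom C (f\<dagger>) = Cod C f" "Cod C (f\<dagger>) = Dom C f" "(f\<dagger>)\<dagger> = f"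
  using Dag_hom[of f "Dom C f" "Cod C f"] Dag_Dag assms by auto

lemma Dag_Comp_simp [simp]:
  assumes "f \<in> Arr C" "g \<in> Arr C" "Dom C g = Cod C f"
  shows "(g \<cdot> f)\<dagger> = f\<dagger> \<cdot> g\<dagger>"
  using Dag_Comp assms by auto

lemma Dag_eq_iff: "f \<in> Arr C \<Longrightarrow> g \<in> Arr C \<Longrightarrow> f\<dagger> = g\<dagger> \<longleftrightarrow> f = g"
  using Dag_Dag by metis

lemma zero_arr_Dag:
  assumes "zero_arr C f"
  shows "zero_arr C (f\<dagger>)"
  using assms
proof (rule zero_arrE)
  fix Z a b
  assume "zero_object C Z" "a \<in> hom C (Dom C f) Z" "b \<in> hom C Z (Cod C f)" "b \<cdot> a = f"
  then show ?thesis
    using zero_arrI[of Z "b\<dagger>" _ "a\<dagger>"] Dag_Comp_simp[of a b] by simp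
qed

lemma zero_arr_Dag_iff: "f \<in> Arr C \<Longrightarrow> zero_arr C (f\<dagger>) \<longleftrightarrow> zero_arr C f"
  using zero_arr_Dag[of f] zero_arr_Dag[of "f\<dagger>"] by auto

lemma dagger_mono_Arr [simp]: "dagger_mono C k \<Longrightarrow> k \<in> Arr C"
  by (simp add: dagger_mono_def)

lemma dagger_monoI: "f \<in> Arr C \<Longrightarrow> f\<dagger> \<cdot> f = Id C (Dom C f) \<Longrightarrow> dagger_mono C f"
  by (simp add: dagger_mono_def)

lemma dagger_mono_Dag_Comp [simp]:
  assumes "dagger_mono C k"
  shows "k\<dagger> \<cdot> k = Id C (Dom C k)"
    and "x \<in> Arr C \<Longrightarrow> Cod C x = Dom C k \<Longrightarrow> k\<dagger> \<cdot> (k \<cdot> x) = x"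
proof -
  show id: "k\<dagger> \<cdot> k = Id C (Dom C k)"
    using assms by (simp add: dagger_mono_def)
  show "k\<dagger> \<cdot> (k \<cdot> x) = x" if "x \<in> Arr C" "Cod C x = Dom C k"
    using that assoc[of x k "k\<dagger>"] assms by (simp add: id)
qed

lemma dagger_mono_cancel:
  assumes "dagger_mono C k" "k \<cdot> a = k \<cdot> b"
    and "a \<in> Arr C" "b \<in> Arr C" "Cod C a = Dom C k" "Cod C b = Dom C k"
  shows "a = b"
  using dagger_mono_Dag_Comp(2)[OF assms(1)] assms(2-) by metis

lemma dagger_mono_mono_arr: "dagger_mono C k \<Longrightarrow> mono_arr C k"
  using dagger_mono_cancel[of k] by (auto simp: mono_arr_def)

lemma dagger_mono_Comp:
  assumes "dagger_mono C m" "dagger_mono C p" "Cod C p = Dom C m"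
  shows "dagger_mono C (m \<cdot> p)"
  using assms by (intro dagger_monoI) simp_all

lemma factors_through_dagger_mono_iff:
  assumes "dagger_mono C k" "g \<in> Arr C" "Cod C g = Cod C k"
  shows "factors_through C g k \<longleftrightarrow> k \<cdot> (k\<dagger> \<cdot> g) = g"
proof
  assume "factors_through C g k"
  then obtain h where h: "h \<in> Arr C" "Cod C h = Dom C k" "k \<cdot> h = g"
    by (rule factors_throughE)
  then have "k\<dagger> \<cdot> g = h"
    using dagger_mono_Dag_Comp(2)[OF assms(1)] by blast
  then show "k \<cdot> (k\<dagger> \<cdot> g) = g"
    using h by simp
next
  assume "k \<cdot> (k\<dagger> \<cdot> g) = g"
  then show "factors_through C g k"
    using assms by (intro factors_throughI[where h = "k\<dagger> \<cdot> g"]) auto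
qed

lemma is_kernel_dagger_mono [simp]: "is_kernel C k \<Longrightarrow> dagger_mono C k"
  by (simp add: is_kernel_def)

lemma kernel_of_is_kernel: "kernel_of C k f \<Longrightarrow> dagger_mono C k \<Longrightarrow> is_kernel C k"
  unfolding is_kernel_def by blast

lemma is_kernelE:
  assumes "is_kernel C k"
  obtains f where "kernel_of C k f"
  using assms unfolding is_kernel_def by blast

end

text \<open>The orthocomplement of the image of \<open>f\<close>; its dagger is a cokernel of \<open>f\<close>.\<close>

definition perp :: "('o, 'a, 'm) dagger_cat_scheme \<Rightarrow> 'a \<Rightarrow> 'a" where
  "perp C f = (SOME k. kernel_of C k (f\<dagger>\<^bsub>C\<^esub>) \<and> dagger_mono C k)"

context dagger_kernel_category
begin

lemma ex_zero_arr:
  assumes "X \<in> Obj C" "Y \<in> Obj C"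
  obtains f where "zero_arr C f" "f \<in> hom C X Y"
proof -
  obtain Z where Z: "zero_object C Z"
    using ex_zero_object by blast
  obtain a where "a \<in> hom C X Z"
    by (rule zero_object_homE[OF Z assms(1)])
  moreover obtain b where "b \<in> hom C Z Y"
    by (rule zero_object_homE[OF Z assms(2)])
  ultimately show thesis
    using that[of "b \<cdot> a"] zero_arrI[OF Z] by simp
qed

lemma perp_kernel_of:
  assumes "f \<in> Arr C"
  shows "kernel_of C (perp C f) (f\<dagger>)" "dagger_mono C (perp C f)"
  using someI_ex[OF ex_kernel[of "f\<dagger>"]] assms by (auto simp: perp_def)

lemma perp_simps [simp]:
  assumes "f \<in> Arr C"
  shows "perp C f \<in> Arr C" "Cod C (perp C f) = Cod C f" "is_kernel C (perp C f)"
  using perp_kernel_of[OF assms] kernel_ofD[OF perp_kernel_of(1)[OF assms]] assms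
    kernel_of_is_kernel by auto

lemma zero_arr_Dag_Comp_iff_factors_through_perp:
  assumes "f \<in> Arr C" "g \<in> Arr C" "Cod C g = Cod C f"
  shows "zero_arr C (f\<dagger> \<cdot> g) \<longleftrightarrow> factors_through C g (perp C f)"
  using kernel_of_factors_through_iff[OF perp_kernel_of(1)] assms by simp

lemma zero_arr_Dag_Comp_perp: "f \<in> Arr C \<Longrightarrow> zero_arr C (f\<dagger> \<cdot> perp C f)"
  by (simp add: zero_arr_Dag_Comp_iff_factors_through_perp factors_through_refl)

lemma zero_arr_perp_Dag_Comp: "f \<in> Arr C \<Longrightarrow> zero_arr C ((perp C f)\<dagger> \<cdot> f)"
  using zero_arr_Dag[OF zero_arr_Dag_Comp_perp] by simp

lemma perp_Dag_cokernel:
  assumes "f \<in> Arr C" "y \<in> Arr C" "Dom C y = Cod C f" and zero: "zero_arr C (y \<cdot> f)"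
  shows "y \<cdot> (perp C f \<cdot> (perp C f)\<dagger>) = y"
proof -
  have "zero_arr C (f\<dagger> \<cdot> y\<dagger>)"
    using zero_arr_Dag[OF zero] assms by simp
  then have "perp C f \<cdot> ((perp C f)\<dagger> \<cdot> y\<dagger>) = y\<dagger>"
    using assms
    by (simp add: zero_arr_Dag_Comp_iff_factors_through_perp factors_through_dagger_mono_iff)
  then have "(y \<cdot> (perp C f \<cdot> (perp C f)\<dagger>))\<dagger> = y\<dagger>"
    using assms by simp
  then show ?thesis
    using assms by (subst (asm) Dag_eq_iff) simp_all
qed

lemma zero_arr_Comp_perp_trans:
  assumes "f \<in> Arr C" "y \<in> Arr C" "h \<in> Arr C" "Dom C y = Cod C f" "Cod C h = Cod C f"
    and "zero_arr C (y \<cdot> f)" and zero: "zero_arr C ((perp C f)\<dagger> \<cdot> h)"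
  shows "zero_arr C (y \<cdot> h)"
proof -
  have "zero_arr C ((y \<cdot> perp C f) \<cdot> ((perp C f)\<dagger> \<cdot> h))"
    using assms by (intro zero_arr_Comp_left[OF zero]) auto
  also have "(y \<cdot> perp C f) \<cdot> ((perp C f)\<dagger> \<cdot> h) = (y \<cdot> (perp C f \<cdot> (perp C f)\<dagger>)) \<cdot> h"
    using assms by simp
  finally show ?thesis
    unfolding perp_Dag_cokernel[OF assms(1,2,4,6)] .
qed

lemma zero_arr_perp_Dag_Comp_if_factors_through:
  assumes "factors_through C g k" "k \<in> Arr C"
  shows "zero_arr C ((perp C k)\<dagger> \<cdot> g)"
proof -
  have "factors_through C ((perp C k)\<dagger> \<cdot> g) ((perp C k)\<dagger> \<cdot> k)"
    using assms by (intro factors_through_Comp_left) auto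
  then show ?thesis
    using zero_arr_factors_through zero_arr_perp_Dag_Comp assms(2) by blast
qed

lemma is_kernel_factors_through_iff:
  assumes k: "is_kernel C k" and g: "g \<in> Arr C" "Cod C g = Cod C k"
  shows "factors_through C g k \<longleftrightarrow> zero_arr C ((perp C k)\<dagger> \<cdot> g)"
proof
  assume zero: "zero_arr C ((perp C k)\<dagger> \<cdot> g)"
  obtain f where f: "kernel_of C k f"
    using k by (rule is_kernelE)
  have "zero_arr C (f \<cdot> g)"
    using kernel_ofD[OF f] g by (intro zero_arr_Comp_perp_trans[OF _ _ _ _ _ _ zero]) auto
  then show "factors_through C g k"
    using kernel_of_factors_through_iff[OF f] kernel_ofD(3)[OF f] g by simp
qed (use zero_arr_perp_Dag_Comp_if_factors_through k in auto)

lemma is_kernelI: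
  assumes k: "dagger_mono C k"
    and factors: "\<And>g. \<lbrakk>g \<in> Arr C; Cod C g = Cod C k; zero_arr C ((perp C k)\<dagger> \<cdot> g)\<rbrakk>
      \<Longrightarrow> factors_through C g k"
  shows "is_kernel C k"
proof (rule kernel_of_is_kernel[OF _ k])
  show "kernel_of C k ((perp C k)\<dagger>)"
    using k factors dagger_mono_mono_arr zero_arr_perp_Dag_Comp_if_factors_through
    by (auto simp: kernel_of_iff)
qed

lemma is_kernel_kernel_of_perp:
  assumes "is_kernel C k"
  shows "kernel_of C k ((perp C k)\<dagger>)"
  using assms dagger_mono_mono_arr is_kernel_factors_through_iff[OF assms]
  by (auto simp: kernel_of_iff)

lemma unitary_is_kernel:
  assumes "dagger_mono C u" "u \<cdot> u\<dagger> = Id C (Cod C u)"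
  shows "is_kernel C u"
proof (rule is_kernelI[OF assms(1)])
  fix g assume "g \<in> Arr C" "Cod C g = Cod C u"
  then have "u \<cdot> (u\<dagger> \<cdot> g) = g"
    using assoc[of g "u\<dagger>" u] assms by simp
  then show "factors_through C g u"
    using assms \<open>g \<in> Arr C\<close> \<open>Cod C g = Cod C u\<close>
    by (simp add: factors_through_dagger_mono_iff)
qed

lemma Id_is_kernel: "X \<in> Obj C \<Longrightarrow> is_kernel C (Id C X)"
  by (rule unitary_is_kernel) (auto intro: dagger_monoI)

lemma is_kernel_from_zero_object:
  assumes Z: "zero_object C Z" "f \<in> Arr C" "Dom C f = Z"
  shows "is_kernel C f"
proof (rule kernel_of_is_kernel)
  have "f\<dagger> \<cdot> f = Id C Z"
    using zero_object_Obj[OF Z(1)] Z(2,3) by (intro zero_object_hom_unique[OF Z(1)]) simp_all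
  then show dagger_mono: "dagger_mono C f"
    using Z(2,3) by (intro dagger_monoI) simp_all
  have zero: "zero_arr C f"
    using Z by (rule zero_arr_from_zero_object)
  have "factors_through C g f" if g: "zero_arr C g" "Cod C g = Cod C f" for g
  proof (rule factors_throughI)
    have gA: "g \<in> Arr C"
      using g(1) by (rule zero_arr_Arr)
    have "zero_arr C (f\<dagger> \<cdot> g)"
      using gA g Z(2) by (intro zero_arr_Comp_left) simp_all
    then have "zero_arr C (f \<cdot> (f\<dagger> \<cdot> g))"
      using gA g Z(2) by (intro zero_arr_Comp_left) simp_all
    then show "f \<cdot> (f\<dagger> \<cdot> g) = g"
      using gA g Z(2) by (intro zero_arr_unique) simp_all
    show "f \<in> Arr C" "f\<dagger> \<cdot> g \<in> Arr C" "Cod C (f\<dagger> \<cdot> g) = Dom C f"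
      using gA g Z(2) by simp_all
  qed
  then show "kernel_of C f (Id C (Cod C f))"
    using Z dagger_mono_mono_arr[OF dagger_mono] zero zero_arr_factors_through
    by (auto simp: kernel_of_iff)
qed

lemma is_kernel_Comp:
  assumes m: "is_kernel C m" and p: "is_kernel C p" and [simp]: "Cod C p = Dom C m"
  shows "is_kernel C (m \<cdot> p)"
proof (rule is_kernelI)
  note [simp] = m p
  show "dagger_mono C (m \<cdot> p)"
    by (simp add: dagger_mono_Comp)
  fix h assume h [simp]: "h \<in> Arr C" "Cod C h = Cod C (m \<cdot> p)"
    and zero: "zero_arr C ((perp C (m \<cdot> p))\<dagger> \<cdot> h)"
  have "zero_arr C ((perp C m)\<dagger> \<cdot> (m \<cdot> p))"
    using factors_throughI[of m p] by (intro zero_arr_perp_Dag_Comp_if_factors_through) auto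
  then have "zero_arr C ((perp C m)\<dagger> \<cdot> h)"
    by (intro zero_arr_Comp_perp_trans[OF _ _ _ _ _ _ zero]) auto
  then have "factors_through C h m"
    by (simp add: is_kernel_factors_through_iff)
  then obtain h' where h' [simp]: "h' \<in> Arr C" "Cod C h' = Dom C m" and mh': "m \<cdot> h' = h"
    by (rule factors_throughE)
  have "zero_arr C (((perp C p)\<dagger> \<cdot> m\<dagger>) \<cdot> (m \<cdot> p))"
    by (simp add: zero_arr_perp_Dag_Comp)
  then have "zero_arr C (((perp C p)\<dagger> \<cdot> m\<dagger>) \<cdot> h)"
    by (intro zero_arr_Comp_perp_trans[OF _ _ _ _ _ _ zero]) auto
  then have "zero_arr C ((perp C p)\<dagger> \<cdot> h')"
    unfolding mh'[symmetric] by simp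
  then have "factors_through C h' p"
    by (simp add: is_kernel_factors_through_iff)
  then show "factors_through C h (m \<cdot> p)"
    unfolding mh'[symmetric] by (intro factors_through_Comp_left) auto
qed

lemma is_kernel_Comp_cancel:
  assumes n [simp]: "dagger_mono C n" and nq: "is_kernel C (n \<cdot> q)"
    and [simp]: "q \<in> Arr C" "Cod C q = Dom C n"
  shows "is_kernel C q"
proof (rule is_kernelI)
  have "q\<dagger> \<cdot> q = (n \<cdot> q)\<dagger> \<cdot> (n \<cdot> q)"
    by simp
  also have "\<dots> = Id C (Dom C q)"
    using dagger_mono_Dag_Comp(1)[OF is_kernel_dagger_mono[OF nq]] by simp
  finally show "dagger_mono C q"
    by (intro dagger_monoI) simp_all
  fix h assume h [simp]: "h \<in> Arr C" "Cod C h = Cod C q" and zero: "zero_arr C ((perp C q)\<dagger> \<cdot> h)"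
  have "zero_arr C (((perp C (n \<cdot> q))\<dagger> \<cdot> n) \<cdot> q)"
    using zero_arr_perp_Dag_Comp[of "n \<cdot> q"] by simp
  then have "zero_arr C (((perp C (n \<cdot> q))\<dagger> \<cdot> n) \<cdot> h)"
    by (intro zero_arr_Comp_perp_trans[OF _ _ _ _ _ _ zero]) auto
  then have "factors_through C (n \<cdot> h) (n \<cdot> q)"
    using nq by (simp add: is_kernel_factors_through_iff)
  then obtain t where t: "t \<in> Arr C" "Cod C t = Dom C q" "n \<cdot> (q \<cdot> t) = n \<cdot> h"
    by (rule factors_throughE) simp
  have "q \<cdot> t = h"
    by (rule dagger_mono_cancel[OF n t(3)]) (simp_all add: t(1,2))
  then show "factors_through C h q"
    using t(1,2) by (intro factors_throughI) auto
qed

lemma ex_pullback_of_kernel: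
  assumes [simp]: "is_kernel C n" "f \<in> Arr C" "Cod C f = Cod C n"
  obtains p q where "is_pullback C f n p q" "is_kernel C p"
proof -
  obtain p where p: "kernel_of C p ((perp C n)\<dagger> \<cdot> f)" "dagger_mono C p"
    using ex_kernel[of "(perp C n)\<dagger> \<cdot> f"] by auto
  note [simp] = kernel_ofD(2,3)[OF p(1)]
  have p_iff: "factors_through C a p \<longleftrightarrow> factors_through C (f \<cdot> a) n"
    if "a \<in> Arr C" "Cod C a = Dom C f" for a
    using kernel_of_factors_through_iff[OF p(1), of a] that
    by (simp add: is_kernel_factors_through_iff)
  have "factors_through C (f \<cdot> p) n"
    using p_iff[of p] factors_through_refl[of p] by simp
  then obtain q where "q \<in> Arr C" "Dom C q = Dom C p" "Cod C q = Dom C n" "n \<cdot> q = f \<cdot> p"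
    by (rule factors_throughE) simp
  then have "is_pullback C f n p q"
    using p(2) p_iff dagger_mono_mono_arr by (intro is_pullbackI_mono) simp_all
  then show thesis
    using kernel_of_is_kernel[OF p] by (rule that)
qed

lemma ex_pullback_of_kernels:
  assumes m: "is_kernel C m" and n: "is_kernel C n" and mn: "Cod C m = Cod C n"
  obtains p q where "is_pullback C m n p q" "is_kernel C p" "is_kernel C q"
proof -
  obtain p q where pb: "is_pullback C m n p q" and p: "is_kernel C p"
    using ex_pullback_of_kernel[OF n, of m] m mn by auto
  then have q: "q \<in> Arr C" "Cod C q = Dom C n" and "Cod C p = Dom C m" "m \<cdot> p = n \<cdot> q"
    by (auto simp: is_pullback_def)
  then have "is_kernel C (n \<cdot> q)"
    using is_kernel_Comp[OF m p] by simp
  then have "is_kernel C q"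
    using is_kernel_Comp_cancel[OF is_kernel_dagger_mono[OF n]] q by blast
  with pb p show thesis
    by (rule that)
qed

end

context boolean_dagger_kernel_category
begin

lemma disjoint_kernels_orthogonal:
  assumes m: "is_kernel C m" and n: "is_kernel C n" and mn: "Cod C m = Cod C n"
    and disjoint: "\<And>g. \<lbrakk>factors_through C g m; factors_through C g n\<rbrakk> \<Longrightarrow> zero_arr C g"
  shows "zero_arr C (m\<dagger> \<cdot> n)"
proof -
  obtain p q where pb: "is_pullback C m n p q"
    using ex_pullback_of_kernels[OF m n mn] by blast
  then have "factors_through C (m \<cdot> p) m" "factors_through C (m \<cdot> p) n"
    using factors_throughI[of m p] factors_throughI[of n q] m n by (auto simp: is_pullback_def)
  then show ?thesis
    using boolean[OF m n mn pb] disjoint by blast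
qed

text \<open>Booleanness makes the projections onto kernels commute: \<open>m\<close> meets the complement of
  \<open>m \<and> n\<close> in \<open>n\<close> trivially, hence is orthogonal to it.\<close>

lemma pullback_complement_orthogonal:
  assumes [simp]: "is_kernel C m" "is_kernel C n"
    and pb: "is_pullback C m n p q" and [simp]: "is_kernel C q"
  shows "zero_arr C (m\<dagger> \<cdot> (n \<cdot> perp C q))"
proof (rule disjoint_kernels_orthogonal)
  have [simp]: "Cod C n = Cod C m" "Cod C q = Dom C n" and square: "m \<cdot> p = n \<cdot> q"
    using pb by (auto simp: is_pullback_def)
  show "is_kernel C m" "is_kernel C (n \<cdot> perp C q)" "Cod C m = Cod C (n \<cdot> perp C q)"
    by (simp_all add: is_kernel_Comp)
  fix g assume gm: "factors_through C g m" and gn: "factors_through C g (n \<cdot> perp C q)"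
  have "factors_through C g n"
    using factors_throughI[of n "perp C q"] by (intro factors_through_trans[OF gn]) auto
  then have "factors_through C g (n \<cdot> q)"
    using is_pullback_factors_through[OF pb gm] square by simp
  then obtain h where h: "h \<in> Arr C" "Dom C h = Dom C g" "Cod C h = Dom C q" "n \<cdot> (q \<cdot> h) = g"
    by (rule factors_throughE) simp
  then have [simp]: "g \<in> Arr C" "Cod C g = Cod C n"
    by auto
  have "factors_through C (n\<dagger> \<cdot> g) (n\<dagger> \<cdot> (n \<cdot> perp C q))"
    by (rule factors_through_Comp_left[OF gn]) simp_all
  then have "zero_arr C (q\<dagger> \<cdot> (n\<dagger> \<cdot> g))"
    by (simp add: zero_arr_Dag_Comp_iff_factors_through_perp)
  then have "zero_arr C h"
    using h by auto
  then show "zero_arr C g"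
    using h zero_arr_Comp_left[of h "n \<cdot> q"] by simp
qed

lemma Dag_Comp_kernels_pullback:
  assumes m [simp]: "is_kernel C m" and n [simp]: "is_kernel C n"
    and pb: "is_pullback C m n p q" and q [simp]: "is_kernel C q"
  shows "m\<dagger> \<cdot> n = p \<cdot> q\<dagger>"
proof -
  have [simp]: "p \<in> Arr C" "Cod C n = Cod C m" "Cod C p = Dom C m" "Cod C q = Dom C n"
    "Dom C q = Dom C p" and square: "m \<cdot> p = n \<cdot> q"
    using pb by (auto simp: is_pullback_def)
  have "zero_arr C ((perp C q)\<dagger> \<cdot> (n\<dagger> \<cdot> m))"
    using pullback_complement_orthogonal[OF m n pb q]
    by (subst zero_arr_Dag_iff[symmetric]) simp_all
  then have "q \<cdot> (q\<dagger> \<cdot> (n\<dagger> \<cdot> m)) = n\<dagger> \<cdot> m"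
    by (simp add: is_kernel_factors_through_iff[symmetric] factors_through_dagger_mono_iff)
  then have "(q \<cdot> (q\<dagger> \<cdot> (n\<dagger> \<cdot> m)))\<dagger> = (n\<dagger> \<cdot> m)\<dagger>"
    by simp
  then have "m\<dagger> \<cdot> n = m\<dagger> \<cdot> ((n \<cdot> q) \<cdot> q\<dagger>)"
    by simp
  also have "\<dots> = p \<cdot> q\<dagger>"
    unfolding square[symmetric] by simp
  finally show ?thesis .
qed

end

section \<open>Zero-monos and cokernel-kernel factorisations\<close>

text \<open>An arrow of \<open>kck C\<close> is the set of all cokernel-kernel factorisations of its underlying arrow.\<close>

definition kck_factorisations :: "('o, 'a, 'm) dagger_cat_scheme \<Rightarrow> 'a \<Rightarrow> ('a \<times> 'a) set" where
  "kck_factorisations C f = {(c, k). kck_pair C c k \<and> k \<cdot>\<^bsub>C\<^esub> c = f}"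

definition kck_factorisable :: "('o, 'a, 'm) dagger_cat_scheme \<Rightarrow> 'a \<Rightarrow> bool" where
  "kck_factorisable C f \<longleftrightarrow> kck_factorisations C f \<noteq> {}"

lemma kck_factorisable_iff: "kck_factorisable C f \<longleftrightarrow> (\<exists>c k. kck_pair C c k \<and> k \<cdot>\<^bsub>C\<^esub> c = f)"
  by (simp add: kck_factorisable_def kck_factorisations_def)

context dagger_kernel_category
begin

lemma mono_arr_zero_mono:
  assumes m: "mono_arr C m"
  shows "zero_mono C m"
  unfolding zero_mono_def
proof (intro conjI ballI impI)
  show [simp]: "m \<in> Arr C"
    using m by (rule mono_arr_Arr)
  fix f assume f [simp]: "f \<in> Arr C" and mf: "Cod C f = Dom C m \<and> zero_arr C (m \<cdot> f)"
  obtain z where z: "zero_arr C z" "z \<in> hom C (Dom C f) (Dom C m)"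
    using ex_zero_arr[of "Dom C f" "Dom C m"] by auto
  then have "m \<cdot> z = m \<cdot> f"
    using mf zero_arr_Comp_left[OF z(1), of m] by (intro zero_arr_unique) simp_all
  then have "z = f"
    by (rule mono_arr_cancel[OF m]) (use z(2) mf in simp_all)
  then show "zero_arr C f"
    using z(1) by simp
qed

lemma mono_classes_coincide:
  assumes "\<And>m. zero_mono C m \<Longrightarrow> is_kernel C m"
  shows "{m. is_kernel C m} = {m. dagger_mono C m}"
    and "{m. dagger_mono C m} = {m. mono_arr C m}"
    and "{m. mono_arr C m} = {m. zero_mono C m}"
  using assms is_kernel_dagger_mono dagger_mono_mono_arr mono_arr_zero_mono by blast+

lemma zero_mono_iff_zero_arr_kernel:
  assumes "kernel_of C k m"
  shows "zero_mono C m \<longleftrightarrow> zero_arr C k"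
  using kernel_ofD[OF assms] kernel_of_factors_through_iff[OF assms] zero_arr_factors_through
  unfolding zero_mono_def by metis

lemma kck_pairI:
  assumes "is_kernel C (c\<dagger>)" "is_kernel C k" "c \<in> Arr C" "Cod C c = Dom C k"
  shows "kck_pair C c k"
  using assms by (simp add: kck_pair_def is_cokernel_def)

lemma kck_pairD:
  assumes "kck_pair C c k"
  shows "c \<in> Arr C" "is_kernel C (c\<dagger>)" "is_kernel C k" "Cod C c = Dom C k"
  using assms by (simp_all add: kck_pair_def is_cokernel_def)

lemma kck_pair_cokernel_Dag:
  assumes "kck_pair C c k"
  shows "c \<cdot> c\<dagger> = Id C (Dom C k)"
    and "x \<in> Arr C \<Longrightarrow> Cod C x = Dom C k \<Longrightarrow> c \<cdot> (c\<dagger> \<cdot> x) = x"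
  using kck_pairD[OF assms] dagger_mono_Dag_Comp[of "c\<dagger>"] by auto

lemma zero_mono_kck_factorisable_is_kernel:
  assumes "kck_factorisable C m" and zero_mono: "zero_mono C m"
  shows "is_kernel C m"
proof -
  obtain c k where ck: "kck_pair C c k" and kc: "k \<cdot> c = m"
    using assms(1) unfolding kck_factorisable_iff by blast
  note [simp] = kck_pairD[OF ck]
  have "zero_arr C (c \<cdot> perp C (c\<dagger>))"
    using zero_arr_Dag_Comp_perp[of "c\<dagger>"] by simp
  then have "zero_arr C (k \<cdot> (c \<cdot> perp C (c\<dagger>)))"
    by (rule zero_arr_Comp_left) simp_all
  then have "zero_arr C (m \<cdot> perp C (c\<dagger>))"
    unfolding kc[symmetric] by simp
  moreover have "\<forall>f \<in> Arr C. Cod C f = Dom C c \<and> zero_arr C (m \<cdot> f) \<longrightarrow> zero_arr C f"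
    using zero_mono unfolding zero_mono_def kc[symmetric] by simp
  ultimately have "zero_arr C (perp C (c\<dagger>))"
    by simp
  then have "zero_arr C ((perp C (c\<dagger>))\<dagger> \<cdot> Id C (Dom C c))"
    using zero_arr_Dag by simp
  then have "c\<dagger> \<cdot> c = Id C (Dom C c)"
    using is_kernel_factors_through_iff[of "c\<dagger>" "Id C (Dom C c)"]
    by (simp add: factors_through_dagger_mono_iff)
  then have "is_kernel C c"
    by (intro unitary_is_kernel dagger_monoI) (simp_all add: kck_pair_cokernel_Dag[OF ck])
  then show ?thesis
    unfolding kc[symmetric] by (intro is_kernel_Comp) simp_all
qed

lemma zero_mono_Comp_perp_kernel:
  assumes n: "kernel_of C n f"
  shows "zero_mono C (f \<cdot> perp C n)"
  unfolding zero_mono_def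
proof (intro conjI ballI impI)
  note [simp] = kernel_ofD(1-3)[OF n]
  let ?r = "perp C n"
  show "f \<cdot> ?r \<in> Arr C"
    by simp
  fix g assume [simp]: "g \<in> Arr C" and g: "Cod C g = Dom C (f \<cdot> ?r) \<and> zero_arr C ((f \<cdot> ?r) \<cdot> g)"
  then have [simp]: "Cod C g = Dom C ?r"
    by simp
  have "factors_through C (?r \<cdot> g) n"
    using kernel_of_factors_through_iff[OF n, of "?r \<cdot> g"] g by simp
  then have "zero_arr C (?r\<dagger> \<cdot> (?r \<cdot> g))"
    by (rule zero_arr_perp_Dag_Comp_if_factors_through) simp
  then show "zero_arr C g"
    by simp
qed

lemma zero_monos_kernels_kck_factorisable:
  assumes "\<And>m. zero_mono C m \<Longrightarrow> is_kernel C m" and f [simp]: "f \<in> Arr C"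
  shows "kck_factorisable C f"
proof -
  obtain n where n: "kernel_of C n f"
    using ex_kernel[OF f] by blast
  note [simp] = kernel_ofD(2,3)[OF n]
  have "is_kernel C (f \<cdot> perp C n)"
    using assms(1) zero_mono_Comp_perp_kernel[OF n] .
  then have "kck_pair C ((perp C n)\<dagger>) (f \<cdot> perp C n)"
    by (intro kck_pairI) simp_all
  moreover have "(f \<cdot> perp C n) \<cdot> (perp C n)\<dagger> = f"
    using perp_Dag_cokernel[of n f] kernel_ofD(4)[OF n] by simp
  ultimately show ?thesis
    unfolding kck_factorisable_iff by blast
qed

lemma is_kernel_kck_factorisable:
  assumes [simp]: "is_kernel C k"
  shows "kck_factorisable C k"
proof -
  have "kck_pair C (Id C (Dom C k)) k" "k \<cdot> Id C (Dom C k) = k"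
    by (auto intro!: kck_pairI Id_is_kernel)
  then show ?thesis
    unfolding kck_factorisable_iff by blast
qed

lemma kck_pair_same_composite:
  assumes ck: "kck_pair C c k" and ck': "kck_pair C c' k'" and same: "k' \<cdot> c' = k \<cdot> c"
  shows "Dom C c' = Dom C c" "Cod C k' = Cod C k" "c'\<dagger> \<cdot> c' = c\<dagger> \<cdot> c"
proof -
  note [simp] = kck_pairD[OF ck] kck_pairD[OF ck']
  show [simp]: "Dom C c' = Dom C c" "Cod C k' = Cod C k"
    using arg_cong[OF same, of "Dom C"] arg_cong[OF same, of "Cod C"] by auto
  have "(k' \<cdot> c')\<dagger> \<cdot> (k' \<cdot> c') = (k \<cdot> c)\<dagger> \<cdot> (k \<cdot> c)"
    unfolding same ..
  then show "c'\<dagger> \<cdot> c' = c\<dagger> \<cdot> c"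
    by simp
qed

lemma kck_pair_same_composite_inverse:
  assumes ck: "kck_pair C c k" and ck': "kck_pair C c' k'" and "k' \<cdot> c' = k \<cdot> c"
  shows "(c \<cdot> c'\<dagger>) \<cdot> (c' \<cdot> c\<dagger>) = Id C (Cod C c)"
proof -
  note [simp] = kck_pairD[OF ck] kck_pairD[OF ck']
  note same_Dag = kck_pair_same_composite[OF assms]
  have "(c \<cdot> c'\<dagger>) \<cdot> (c' \<cdot> c\<dagger>) = c \<cdot> ((c'\<dagger> \<cdot> c') \<cdot> c\<dagger>)"
    by (simp add: same_Dag(1))
  also have "\<dots> = (c \<cdot> c\<dagger>) \<cdot> (c \<cdot> c\<dagger>)"
    unfolding same_Dag(3) by simp
  finally show ?thesis
    by (simp add: kck_pair_cokernel_Dag[OF ck])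
qed

lemma kck_factorisation_unique:
  assumes ck: "kck_pair C c k" and ck': "kck_pair C c' k'" and same: "k' \<cdot> c' = k \<cdot> c"
  shows "inverse_arrows C (c' \<cdot> c\<dagger>) (c \<cdot> c'\<dagger>)" "c' = (c' \<cdot> c\<dagger>) \<cdot> c" "k' = k \<cdot> (c \<cdot> c'\<dagger>)"
proof -
  note [simp] = kck_pairD[OF ck] kck_pairD[OF ck']
  note [simp] = kck_pair_same_composite[OF assms]
  show "inverse_arrows C (c' \<cdot> c\<dagger>) (c \<cdot> c'\<dagger>)"
    using kck_pair_same_composite_inverse[OF ck ck' same]
      kck_pair_same_composite_inverse[OF ck' ck same[symmetric]]
    by (simp add: inverse_arrows_def)
  show "c' = (c' \<cdot> c\<dagger>) \<cdot> c"
    using kck_pair_cokernel_Dag(2)[OF ck', of c'] by simp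
  have "k \<cdot> (c \<cdot> c'\<dagger>) = (k \<cdot> c) \<cdot> c'\<dagger>"
    by simp
  also have "\<dots> = k'"
    unfolding same[symmetric] by (simp add: kck_pair_cokernel_Dag[OF ck'])
  finally show "k' = k \<cdot> (c \<cdot> c'\<dagger>)" ..
qed

lemma kck_class_eq_kck_factorisations:
  assumes ck: "kck_pair C c k"
  shows "kck_class C c k = kck_factorisations C (k \<cdot> c)"
proof -
  note [simp] = kck_pairD[OF ck]
  have "(k \<cdot> \<psi>) \<cdot> (\<phi> \<cdot> c) = k \<cdot> c" if "inverse_arrows C \<phi> \<psi>" "Dom C \<phi> = Cod C c" for \<phi> \<psi>
  proof -
    have iso: "\<phi> \<in> Arr C" "\<psi> \<in> Arr C" "Dom C \<phi> = Dom C k" "Cod C \<psi> = Dom C k" "Dom C \<psi> = Cod C \<phi>"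
      and inverse: "\<psi> \<cdot> \<phi> = Id C (Dom C k)"
      using that by (auto simp: inverse_arrows_def)
    have "(k \<cdot> \<psi>) \<cdot> (\<phi> \<cdot> c) = k \<cdot> ((\<psi> \<cdot> \<phi>) \<cdot> c)"
      using iso by simp
    then show ?thesis
      unfolding inverse by simp
  qed
  moreover have "\<exists>\<phi> \<psi>. inverse_arrows C \<phi> \<psi> \<and> Dom C \<phi> = Cod C c \<and> c' = \<phi> \<cdot> c \<and> k' = k \<cdot> \<psi>"
    if ck': "kck_pair C c' k'" and same: "k' \<cdot> c' = k \<cdot> c" for c' k'
    using kck_factorisation_unique[OF ck ck' same] kck_pairD[OF ck']
      kck_pair_same_composite(1)[OF ck ck' same]
    by (intro exI[of _ "c' \<cdot> c\<dagger>"] exI[of _ "c \<cdot> c'\<dagger>"]) simp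
  ultimately show ?thesis
    unfolding kck_class_def kck_factorisations_def by auto
qed

end

section \<open>Kernel posets and the kernel fibration\<close>

definition maps_into :: "('o, 'a, 'm) dagger_cat_scheme \<Rightarrow> 'a \<Rightarrow> 'a set \<Rightarrow> 'a set \<Rightarrow> bool" where
  "maps_into C f A B \<longleftrightarrow>
    (\<exists>m \<in> A. \<exists>n \<in> B. \<exists>h \<in> hom C (Dom C m) (Dom C n). f \<cdot>\<^bsub>C\<^esub> m = n \<cdot>\<^bsub>C\<^esub> h)"

context dagger_kernel_category
begin

lemma ksub_class_iff:
  assumes m: "is_kernel C m"
  shows "n \<in> ksub_class C m
    \<longleftrightarrow> is_kernel C n \<and> factors_through C n m \<and> factors_through C m n"
proof
  assume "n \<in> ksub_class C m"
  then obtain \<phi> \<psi> where n: "is_kernel C n" and iso: "inverse_arrows C \<phi> \<psi>"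
    and \<phi>: "\<phi> \<in> hom C (Dom C n) (Dom C m)" "m \<cdot> \<phi> = n"
    unfolding ksub_class_def by blast
  note [simp] = m n
  have \<psi>: "\<psi> \<in> Arr C" "Dom C \<psi> = Dom C m" "Cod C \<psi> = Dom C n" "\<phi> \<cdot> \<psi> = Id C (Dom C m)"
    using iso \<phi> by (auto simp: inverse_arrows_def)
  have "n \<cdot> \<psi> = m \<cdot> (\<phi> \<cdot> \<psi>)"
    unfolding \<phi>(2)[symmetric] using \<phi>(1) \<psi>(1-3) by simp
  then have "n \<cdot> \<psi> = m"
    unfolding \<psi>(4) by simp
  then show "is_kernel C n \<and> factors_through C n m \<and> factors_through C m n"
    using n \<phi> \<psi>(1-3) factors_throughI[of m \<phi> n] factors_throughI[of n \<psi> m] by simp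
next
  assume n: "is_kernel C n \<and> factors_through C n m \<and> factors_through C m n"
  then obtain \<phi> \<psi> where "inverse_arrows C \<phi> \<psi>" "\<phi> \<in> hom C (Dom C n) (Dom C m)" "m \<cdot> \<phi> = n"
    using m by (meson mono_arrs_isoE dagger_mono_mono_arr is_kernel_dagger_mono)
  then show "n \<in> ksub_class C m"
    using n unfolding ksub_class_def by blast
qed

lemma ksub_class_self: "is_kernel C m \<Longrightarrow> m \<in> ksub_class C m"
  by (simp add: ksub_class_iff factors_through_refl)

lemma factors_through_kernel_trans:
  "factors_through C f g \<Longrightarrow> factors_through C g k \<Longrightarrow> is_kernel C k \<Longrightarrow> factors_through C f k"
  by (rule factors_through_trans) simp_all

lemma ksub_class_eq_iff:
  assumes "is_kernel C m" "is_kernel C n"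
  shows "ksub_class C m = ksub_class C n \<longleftrightarrow> factors_through C m n \<and> factors_through C n m"
proof
  assume "ksub_class C m = ksub_class C n"
  then show "factors_through C m n \<and> factors_through C n m"
    using ksub_class_self[OF assms(1)] ksub_class_iff[OF assms(2)] by blast
next
  assume "factors_through C m n \<and> factors_through C n m"
  then show "ksub_class C m = ksub_class C n"
    using ksub_class_iff[OF assms(1)] ksub_class_iff[OF assms(2)] assms
    by (blast intro: factors_through_kernel_trans)
qed

lemma KSub_cases:
  assumes "A \<in> KSub C X"
  obtains m where "is_kernel C m" "Cod C m = X" "A = ksub_class C m"
  using assms unfolding KSub_def by blast

lemma KSubI [simp]: "is_kernel C m \<Longrightarrow> Cod C m = X \<Longrightarrow> ksub_class C m \<in> KSub C X"
  unfolding KSub_def by blast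

lemma KSub_is_kernel:
  assumes "A \<in> KSub C X" "m \<in> A"
  shows "is_kernel C m" "Cod C m = X"
  using assms factors_through_Cod[of m]
  by (cases rule: KSub_cases; auto simp: ksub_class_iff)+

lemma KSub_Obj: "A \<in> KSub C X \<Longrightarrow> X \<in> Obj C"
  by (cases rule: KSub_cases) auto

lemma maps_into_iff:
  assumes "A \<in> KSub C (Dom C f)" "f \<in> Arr C"
  shows "maps_into C f A B \<longleftrightarrow> (\<exists>m \<in> A. \<exists>n \<in> B. factors_through C (f \<cdot> m) n)"
proof -
  have "Dom C (f \<cdot> m) = Dom C m" if "m \<in> A" for m
    using KSub_is_kernel[OF assms(1) that] assms(2) by simp
  then show ?thesis
    unfolding maps_into_def factors_through_def by (simp add: eq_commute cong: bex_cong)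
qed

lemma maps_into_ksub_class_iff:
  assumes m [simp]: "is_kernel C m" and n [simp]: "is_kernel C n"
    and [simp]: "f \<in> Arr C" "Dom C f = Cod C m" "Cod C f = Cod C n"
  shows "maps_into C f (ksub_class C m) (ksub_class C n) \<longleftrightarrow> factors_through C (f \<cdot> m) n"
proof -
  have "maps_into C f (ksub_class C m) (ksub_class C n)
      \<longleftrightarrow> (\<exists>m' \<in> ksub_class C m. \<exists>n' \<in> ksub_class C n. factors_through C (f \<cdot> m') n')"
    by (simp add: maps_into_iff)
  also have "\<dots> \<longleftrightarrow> factors_through C (f \<cdot> m) n"
  proof
    assume "\<exists>m' \<in> ksub_class C m. \<exists>n' \<in> ksub_class C n. factors_through C (f \<cdot> m') n'"
    then obtain m' n' where m': "is_kernel C m'" "factors_through C m m'" "factors_through C m' m"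
      and n': "is_kernel C n'" "factors_through C n' n" and fm': "factors_through C (f \<cdot> m') n'"
      using ksub_class_iff[OF m] ksub_class_iff[OF n] by blast
    have "Cod C m' = Cod C m"
      using m'(3) by (rule factors_through_Cod) simp
    then have "factors_through C (f \<cdot> m) (f \<cdot> m')"
      using m' by (intro factors_through_Comp_left) auto
    then show "factors_through C (f \<cdot> m) n"
      using fm' n' n by (blast intro: factors_through_kernel_trans)
  qed (use m n ksub_class_self in blast)
  finally show ?thesis .
qed

lemma ksub_le_ksub_class_iff:
  assumes m: "is_kernel C m" and n: "is_kernel C n" and mn: "Cod C m = Cod C n"
  shows "ksub_le C (ksub_class C m) (ksub_class C n) \<longleftrightarrow> factors_through C m n"
proof -
  have "Id C (Cod C m) \<cdot> x = x" if "x \<in> ksub_class C m" for x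
    using KSub_is_kernel[OF KSubI[OF m refl] that] by simp
  then have "ksub_le C (ksub_class C m) (ksub_class C n)
      \<longleftrightarrow> maps_into C (Id C (Cod C m)) (ksub_class C m) (ksub_class C n)"
    unfolding ksub_le_def maps_into_def by simp
  then show ?thesis
    using m n mn by (simp add: maps_into_ksub_class_iff)
qed

lemma maps_into_Id:
  assumes "A \<in> KSub C X"
  shows "maps_into C (Id C X) A A"
  using assms by (cases rule: KSub_cases) (auto simp: maps_into_ksub_class_iff factors_through_refl)

lemma maps_into_Comp:
  assumes [simp]: "f \<in> Arr C" "g \<in> Arr C" "Dom C g = Cod C f"
    and "A \<in> KSub C (Dom C f)" "B \<in> KSub C (Cod C f)" "B' \<in> KSub C (Cod C g)"
    and "maps_into C f A B" "maps_into C g B B'"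
  shows "maps_into C (g \<cdot> f) A B'"
proof -
  obtain m n l where kernels [simp]: "is_kernel C m" "is_kernel C n" "is_kernel C l"
    and [simp]: "Cod C m = Dom C f" "Cod C n = Cod C f" "Cod C l = Cod C g"
    and classes: "A = ksub_class C m" "B = ksub_class C n" "B' = ksub_class C l"
    using assms(4-6) by (meson KSub_cases)
  have fm: "factors_through C (f \<cdot> m) n" and gn: "factors_through C (g \<cdot> n) l"
    using assms(7,8) unfolding classes by (simp_all add: maps_into_ksub_class_iff)
  have "factors_through C (g \<cdot> (f \<cdot> m)) (g \<cdot> n)"
    by (rule factors_through_Comp_left[OF fm]) simp_all
  then have "factors_through C (g \<cdot> (f \<cdot> m)) l"
    using gn kernels(3) by (rule factors_through_kernel_trans)
  then show ?thesis
    unfolding classes by (simp add: maps_into_ksub_class_iff)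
qed

end

lemma fibration_functor_simps:
  "FObj kernel_fibration_proj (X, A) = X"
  "FArr kernel_fibration_proj (a, f, b) = f"
  "FObj (kernel_fibration_map D F) (X, A) = (FObj F X, ksub_map D F A)"
  "FArr (kernel_fibration_map D F) ((X, A), f, (Y, B))
    = ((FObj F X, ksub_map D F A), FArr F f, (FObj F Y, ksub_map D F B))"
  by (simp_all add: kernel_fibration_proj_def kernel_fibration_map_def Let_def)

context dagger_kernel_category
begin

lemma kernel_fibration_simps:
  "Obj (kernel_fibration C) = {(X, A). A \<in> KSub C X}"
  "Arr (kernel_fibration C) = {((X, A), f, (Y, B)). A \<in> KSub C X \<and> B \<in> KSub C Y
    \<and> f \<in> hom C X Y \<and> maps_into C f A B}"
  "Dom (kernel_fibration C) (a, f, b) = a"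
  "Cod (kernel_fibration C) (a, f, b) = b"
  "Id (kernel_fibration C) a = (a, Id C (fst a), a)"
  "(b, g, c) \<cdot>\<^bsub>kernel_fibration C\<^esub> (a, f, b') = (a, g \<cdot> f, c)"
  unfolding maps_into_def by (auto simp: kernel_fibration_def KSub_Obj simp del: hom_def)

lemma category_kernel_fibration: "category (kernel_fibration C)"
proof
  fix t assume "t \<in> Arr (kernel_fibration C)"
  then show "Dom (kernel_fibration C) t \<in> Obj (kernel_fibration C)"
    "Cod (kernel_fibration C) t \<in> Obj (kernel_fibration C)"
    by (auto simp: kernel_fibration_simps)
next
  fix a assume "a \<in> Obj (kernel_fibration C)"
  then show "Id (kernel_fibration C) a \<in> hom (kernel_fibration C) a a"
    using maps_into_Id KSub_Obj by (auto simp: kernel_fibration_simps)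
next
  fix s t a b c
  assume "s \<in> hom (kernel_fibration C) a b" "t \<in> hom (kernel_fibration C) b c"
  then show "t \<cdot>\<^bsub>kernel_fibration C\<^esub> s \<in> hom (kernel_fibration C) a c"
    by (auto simp: kernel_fibration_simps intro: maps_into_Comp)
next
  fix s a b assume "s \<in> hom (kernel_fibration C) a b"
  then show "s \<cdot>\<^bsub>kernel_fibration C\<^esub> Id (kernel_fibration C) a = s"
    "Id (kernel_fibration C) b \<cdot>\<^bsub>kernel_fibration C\<^esub> s = s"
    by (auto simp: kernel_fibration_simps)
next
  fix s t u a b c d
  assume "s \<in> hom (kernel_fibration C) a b" "t \<in> hom (kernel_fibration C) b c"
    "u \<in> hom (kernel_fibration C) c d"
  then show "(u \<cdot>\<^bsub>kernel_fibration C\<^esub> t) \<cdot>\<^bsub>kernel_fibration C\<^esub> s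
      = u \<cdot>\<^bsub>kernel_fibration C\<^esub> (t \<cdot>\<^bsub>kernel_fibration C\<^esub> s)"
    by (auto simp: kernel_fibration_simps)
qed

lemma is_functor_kernel_fibration_proj:
  "is_functor (kernel_fibration C) C kernel_fibration_proj"
  unfolding is_functor_def
  using category_kernel_fibration category_axioms KSub_Obj
  by (auto simp: kernel_fibration_simps fibration_functor_simps)

end

section \<open>Morphisms of dagger kernel categories\<close>

locale cat_functor =
  fixes C :: "('o, 'a, 'm) cat_scheme" and D :: "('p, 'b, 'n) cat_scheme"
    and F :: "('o, 'a, 'p, 'b) fctr"
  assumes is_functor: "is_functor C D F"
begin

sublocale C: category C + D: category D
  using is_functor by (simp_all add: is_functor_def)

lemma FObj_Obj [simp]: "X \<in> Obj C \<Longrightarrow> FObj F X \<in> Obj D"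
  and FArr_simps [simp]: "f \<in> Arr C \<Longrightarrow> FArr F f \<in> Arr D"
    "f \<in> Arr C \<Longrightarrow> Dom D (FArr F f) = FObj F (Dom C f)"
    "f \<in> Arr C \<Longrightarrow> Cod D (FArr F f) = FObj F (Cod C f)"
  and FArr_Id [simp]: "X \<in> Obj C \<Longrightarrow> FArr F (Id C X) = Id D (FObj F X)"
  and FArr_Comp [simp]: "f \<in> Arr C \<Longrightarrow> g \<in> Arr C \<Longrightarrow> Dom C g = Cod C f
    \<Longrightarrow> FArr F (g \<cdot>\<^bsub>C\<^esub> f) = FArr F g \<cdot>\<^bsub>D\<^esub> FArr F f"
  using is_functor by (auto simp: is_functor_def)

lemma FArr_inverse_arrows:
  "inverse_arrows C \<phi> \<psi> \<Longrightarrow> inverse_arrows D (FArr F \<phi>) (FArr F \<psi>)"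
  by (auto simp: inverse_arrows_def FArr_Comp[symmetric] simp del: FArr_Comp)

lemma FArr_factors_through:
  assumes "factors_through C g k" "k \<in> Arr C"
  shows "factors_through D (FArr F g) (FArr F k)"
  using assms(1)
proof (rule C.factors_throughE)
  fix h assume "h \<in> Arr C" "Cod C h = Dom C k" "k \<cdot>\<^bsub>C\<^esub> h = g"
  then show ?thesis
    using assms(2) by (intro D.factors_throughI[where h = "FArr F h"])
      (auto simp: FArr_Comp[symmetric] simp del: FArr_Comp)
qed

end

locale kernel_functor =
  fixes C :: "('o, 'a, 'm) dagger_cat_scheme" and D :: "('p, 'b, 'n) dagger_cat_scheme"
    and F :: "('o, 'a, 'p, 'b) fctr"
  assumes kernel_morphism: "dagger_kernel_morphism C D F"
begin

sublocale C: dagger_kernel_category C + D: dagger_kernel_category D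
  using kernel_morphism by (simp_all add: dagger_kernel_morphism_def)

sublocale cat_functor C D F
  using kernel_morphism by unfold_locales (simp add: dagger_kernel_morphism_def)

lemma FArr_Dag [simp]: "f \<in> Arr C \<Longrightarrow> FArr F (f\<dagger>\<^bsub>C\<^esub>) = (FArr F f)\<dagger>\<^bsub>D\<^esub>"
  using kernel_morphism by (simp add: dagger_kernel_morphism_def)

lemma FArr_kernel_of: "kernel_of C k f \<Longrightarrow> kernel_of D (FArr F k) (FArr F f)"
  using kernel_morphism by (simp add: dagger_kernel_morphism_def)

lemma FArr_is_kernel [simp]:
  assumes k [simp]: "is_kernel C k"
  shows "is_kernel D (FArr F k)"
proof -
  have "FArr F (k\<dagger>\<^bsub>C\<^esub> \<cdot>\<^bsub>C\<^esub> k) = (FArr F k)\<dagger>\<^bsub>D\<^esub> \<cdot>\<^bsub>D\<^esub> FArr F k"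
    by (subst FArr_Comp) simp_all
  then have "dagger_mono D (FArr F k)"
    by (intro D.dagger_monoI) simp_all
  then show ?thesis
    using k FArr_kernel_of D.kernel_of_is_kernel by (blast elim: C.is_kernelE)
qed

lemma FArr_kck_factorisable:
  assumes "kck_factorisable C f"
  shows "kck_factorisable D (FArr F f)"
proof -
  obtain c k where ck: "kck_pair C c k" and kc: "k \<cdot>\<^bsub>C\<^esub> c = f"
    using assms unfolding kck_factorisable_iff by blast
  note [simp] = C.kck_pairD[OF ck]
  have "is_kernel D (FArr F (c\<dagger>\<^bsub>C\<^esub>))"
    by (rule FArr_is_kernel) simp
  then have "kck_pair D (FArr F c) (FArr F k)"
    by (intro D.kck_pairI) simp_all
  moreover have "FArr F k \<cdot>\<^bsub>D\<^esub> FArr F c = FArr F f"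
    unfolding kc[symmetric] by simp
  ultimately show ?thesis
    unfolding kck_factorisable_iff by blast
qed

lemma ksub_map_ksub_class:
  assumes m: "is_kernel C m"
  shows "ksub_map D F (ksub_class C m) = ksub_class D (FArr F m)"
proof -
  have "ksub_class D (FArr F n) = ksub_class D (FArr F m)" if "n \<in> ksub_class C m" for n
    using that m C.ksub_class_iff[OF m, of n] D.ksub_class_eq_iff FArr_factors_through by simp
  then have "ksub_map D F (ksub_class C m) = (\<Union>n \<in> ksub_class C m. ksub_class D (FArr F m))"
    unfolding ksub_map_def by (rule SUP_cong[OF refl])
  then show ?thesis
    using C.ksub_class_self[OF m] by auto
qed

lemma ksub_map_KSub:
  assumes "A \<in> KSub C X"
  shows "ksub_map D F A \<in> KSub D (FObj F X)"
  using assms by (cases rule: C.KSub_cases) (auto simp: ksub_map_ksub_class)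

lemma maps_into_ksub_map:
  assumes "A \<in> KSub C X" "B \<in> KSub C Y" "f \<in> hom C X Y" "maps_into C f A B"
  shows "maps_into D (FArr F f) (ksub_map D F A) (ksub_map D F B)"
proof -
  obtain m n where [simp]: "is_kernel C m" "is_kernel C n" "Cod C m = X" "Cod C n = Y"
    and classes: "A = ksub_class C m" "B = ksub_class C n"
    using assms(1,2) by (meson C.KSub_cases)
  have "factors_through C (f \<cdot>\<^bsub>C\<^esub> m) n"
    using assms(3,4) unfolding classes by (simp add: C.maps_into_ksub_class_iff)
  then have "factors_through D (FArr F (f \<cdot>\<^bsub>C\<^esub> m)) (FArr F n)"
    by (intro FArr_factors_through) simp_all
  then show ?thesis
    using assms(3) unfolding classes by (simp add: ksub_map_ksub_class D.maps_into_ksub_class_iff)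
qed

lemma is_functor_kernel_fibration_map:
  "is_functor (kernel_fibration C) (kernel_fibration D) (kernel_fibration_map D F)"
  unfolding is_functor_def
proof (intro conjI ballI impI C.category_kernel_fibration D.category_kernel_fibration)
  fix a assume "a \<in> Obj (kernel_fibration C)"
  then show "FObj (kernel_fibration_map D F) a \<in> Obj (kernel_fibration D)"
    "FArr (kernel_fibration_map D F) (Id (kernel_fibration C) a)
      = Id (kernel_fibration D) (FObj (kernel_fibration_map D F) a)"
    by (auto simp: C.kernel_fibration_simps D.kernel_fibration_simps fibration_functor_simps
        ksub_map_KSub C.KSub_Obj)
next
  fix t assume "t \<in> Arr (kernel_fibration C)"
  then show "FArr (kernel_fibration_map D F) t \<in> hom (kernel_fibration D)
      (FObj (kernel_fibration_map D F) (Dom (kernel_fibration C) t))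
      (FObj (kernel_fibration_map D F) (Cod (kernel_fibration C) t))"
    using maps_into_ksub_map ksub_map_KSub
    by (auto simp: C.kernel_fibration_simps D.kernel_fibration_simps fibration_functor_simps)
next
  fix s t
  assume "s \<in> Arr (kernel_fibration C)" "t \<in> Arr (kernel_fibration C)"
    "Dom (kernel_fibration C) t = Cod (kernel_fibration C) s"
  then show "FArr (kernel_fibration_map D F) (t \<cdot>\<^bsub>kernel_fibration C\<^esub> s)
      = FArr (kernel_fibration_map D F) t \<cdot>\<^bsub>kernel_fibration D\<^esub> FArr (kernel_fibration_map D F) s"
    by (auto simp: C.kernel_fibration_simps D.kernel_fibration_simps fibration_functor_simps)
qed

end

section \<open>Wide dagger subcategories\<close>

text \<open>\<open>K\<close> is presented as a wide subcategory of \<open>C\<close> by an injection \<open>J\<close> of its arrows, along which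
  it inherits the category axioms.\<close>

locale wide_dagger_embedding = C: dagger_category C
  for K :: "('o, 'b, 'n) dagger_cat_scheme" and C :: "('o, 'a, 'm) dagger_cat_scheme"
    and J :: "('o, 'b, 'o, 'a) fctr" +
  assumes Obj_eq [simp]: "Obj K = Obj C"
    and FObj_eq [simp]: "X \<in> Obj C \<Longrightarrow> FObj J X = X"
    and inj_on_FArr: "inj_on (FArr J) (Arr K)"
    and FArr_hom: "x \<in> Arr K \<Longrightarrow> FArr J x \<in> hom C (Dom K x) (Cod K x)"
    and Id_closed: "X \<in> Obj C \<Longrightarrow> Id K X \<in> Arr K \<and> FArr J (Id K X) = Id C X"
    and Comp_closed: "\<lbrakk>x \<in> Arr K; y \<in> Arr K; Dom K y = Cod K x\<rbrakk>
      \<Longrightarrow> y \<cdot>\<^bsub>K\<^esub> x \<in> Arr K \<and> FArr J (y \<cdot>\<^bsub>K\<^esub> x) = FArr J y \<cdot>\<^bsub>C\<^esub> FArr J x"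
    and Dag_closed: "x \<in> Arr K \<Longrightarrow> x\<dagger>\<^bsub>K\<^esub> \<in> Arr K \<and> FArr J (x\<dagger>\<^bsub>K\<^esub>) = (FArr J x)\<dagger>\<^bsub>C\<^esub>"
begin

lemma FArr_eq_iff: "x \<in> Arr K \<Longrightarrow> y \<in> Arr K \<Longrightarrow> FArr J x = FArr J y \<longleftrightarrow> x = y"
  using inj_on_FArr by (simp add: inj_on_eq_iff)

lemma FArr_Arr [simp]: "x \<in> Arr K \<Longrightarrow> FArr J x \<in> Arr C"
  and Dom_FArr [simp]: "x \<in> Arr K \<Longrightarrow> Dom C (FArr J x) = Dom K x"
  and Cod_FArr [simp]: "x \<in> Arr K \<Longrightarrow> Cod C (FArr J x) = Cod K x"
  using FArr_hom by auto

lemma Dom_in_Obj [simp]: "x \<in> Arr K \<Longrightarrow> Dom K x \<in> Obj C"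
  and Cod_in_Obj [simp]: "x \<in> Arr K \<Longrightarrow> Cod K x \<in> Obj C"
  using C.Dom_Obj[of "FArr J x"] C.Cod_Obj[of "FArr J x"] by simp_all

lemma closed_Dom_Cod:
  "X \<in> Obj C \<Longrightarrow> Id K X \<in> Arr K \<and> Dom K (Id K X) = X \<and> Cod K (Id K X) = X"
  "\<lbrakk>x \<in> Arr K; y \<in> Arr K; Dom K y = Cod K x\<rbrakk>
    \<Longrightarrow> y \<cdot>\<^bsub>K\<^esub> x \<in> Arr K \<and> Dom K (y \<cdot>\<^bsub>K\<^esub> x) = Dom K x \<and> Cod K (y \<cdot>\<^bsub>K\<^esub> x) = Cod K y"
  "x \<in> Arr K \<Longrightarrow> x\<dagger>\<^bsub>K\<^esub> \<in> Arr K \<and> Dom K (x\<dagger>\<^bsub>K\<^esub>) = Cod K x \<and> Cod K (x\<dagger>\<^bsub>K\<^esub>) = Dom K x"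
  using Id_closed Comp_closed Dag_closed Dom_FArr[symmetric] Cod_FArr[symmetric]
  by (simp_all del: Dom_FArr Cod_FArr)

sublocale K: dagger_category K
  by unfold_locales
    (auto simp: closed_Dom_Cod Id_closed Comp_closed Dag_closed FArr_eq_iff[symmetric])

sublocale J: cat_functor K C J
  using K.category_axioms C.category_axioms
  by unfold_locales (auto simp: is_functor_def Id_closed Comp_closed)

lemma FArr_Dag [simp]: "x \<in> Arr K \<Longrightarrow> FArr J (x\<dagger>\<^bsub>K\<^esub>) = (FArr J x)\<dagger>\<^bsub>C\<^esub>"
  by (simp add: Dag_closed)

lemma dagger_mono_iff:
  assumes "x \<in> Arr K"
  shows "dagger_mono K x \<longleftrightarrow> dagger_mono C (FArr J x)"
  unfolding dagger_mono_def
  using assms FArr_eq_iff[of "x\<dagger>\<^bsub>K\<^esub> \<cdot>\<^bsub>K\<^esub> x" "Id K (Dom K x)"] by simp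

lemma ex_unique_lift:
  assumes F: "is_functor E C F" and range: "FArr F ` Arr E \<subseteq> FArr J ` Arr K"
  shows "\<exists>G. is_functor E K G \<and> functor_eq E (functor_comp J G) F
    \<and> (\<forall>G'. is_functor E K G' \<and> functor_eq E (functor_comp J G') F \<longrightarrow> functor_eq E G' G)"
proof -
  interpret F: cat_functor E C F
    by unfold_locales (rule F)
  define lift where "lift f = inv_into (Arr K) (FArr J) (FArr F f)" for f
  have lift [simp]: "lift f \<in> Arr K" "FArr J (lift f) = FArr F f" if "f \<in> Arr E" for f
    using that range f_inv_into_f[of "FArr F f" "FArr J" "Arr K"]
      inv_into_into[of "FArr F f" "FArr J" "Arr K"] unfolding lift_def by blast+
  have [simp]: "Dom K (lift f) = FObj F (Dom E f)" "Cod K (lift f) = FObj F (Cod E f)"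
    if "f \<in> Arr E" for f
    using that Dom_FArr[of "lift f"] Cod_FArr[of "lift f"] by simp_all
  define G where "G = \<lparr>FObj = FObj F, FArr = lift\<rparr>"
  have "is_functor E K G"
    unfolding is_functor_def G_def using F.C.category_axioms K.category_axioms
    by (auto simp: FArr_eq_iff[symmetric])
  moreover have "functor_eq E (functor_comp J G) F"
    by (simp add: functor_eq_def functor_comp_def G_def)
  moreover have "functor_eq E G' G"
    if G': "is_functor E K G'" "functor_eq E (functor_comp J G') F" for G'
  proof -
    interpret G': cat_functor E K G'
      by unfold_locales (rule G'(1))
    show ?thesis
      using G'(2) G'.FObj_Obj
      by (auto simp: functor_eq_def functor_comp_def G_def FArr_eq_iff[symmetric])
  qed
  ultimately show ?thesis by blast
qed

end

locale wide_kernel_embedding = wide_dagger_embedding K C J + C: dagger_kernel_category C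
  for K :: "('o, 'b, 'n) dagger_cat_scheme" and C :: "('o, 'a, 'm) dagger_cat_scheme"
    and J :: "('o, 'b, 'o, 'a) fctr" +
  assumes kernel_in_range: "is_kernel C k \<Longrightarrow> k \<in> FArr J ` Arr K"
begin

lemma kernelE:
  assumes "is_kernel C k"
  obtains x where "x \<in> Arr K" "FArr J x = k"
  using kernel_in_range[OF assms] by blast

lemma factors_through_iff:
  assumes "dagger_mono K k" "g \<in> Arr K" "Cod K g = Cod K k"
  shows "factors_through K g k \<longleftrightarrow> factors_through C (FArr J g) (FArr J k)"
proof -
  have "FArr J (k \<cdot>\<^bsub>K\<^esub> (k\<dagger>\<^bsub>K\<^esub> \<cdot>\<^bsub>K\<^esub> g)) = FArr J k \<cdot>\<^bsub>C\<^esub> ((FArr J k)\<dagger>\<^bsub>C\<^esub> \<cdot>\<^bsub>C\<^esub> FArr J g)"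
    using assms by simp
  then show ?thesis
    using assms dagger_mono_iff[of k] FArr_eq_iff[of "k \<cdot>\<^bsub>K\<^esub> (k\<dagger>\<^bsub>K\<^esub> \<cdot>\<^bsub>K\<^esub> g)" g]
    by (simp add: K.factors_through_dagger_mono_iff C.factors_through_dagger_mono_iff)
qed

lemma zero_object_arr_in_range:
  assumes "zero_object C Z" "f \<in> Arr C" "Dom C f = Z \<or> Cod C f = Z"
  shows "f \<in> FArr J ` Arr K"
  using assms(3)
proof
  assume "Dom C f = Z"
  then show ?thesis
    using C.is_kernel_from_zero_object assms(1,2) kernel_in_range by blast
next
  assume "Cod C f = Z"
  then have "is_kernel C (f\<dagger>\<^bsub>C\<^esub>)"
    using assms(1,2) by (intro C.is_kernel_from_zero_object) simp_all
  then obtain x where "x \<in> Arr K" "FArr J x = f\<dagger>\<^bsub>C\<^esub>"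
    by (rule kernelE)
  then show ?thesis
    using assms(2) by (intro image_eqI[of _ _ "x\<dagger>\<^bsub>K\<^esub>"]) simp_all
qed

lemma zero_objectI:
  assumes Z: "zero_object C Z"
  shows "zero_object K Z"
proof -
  have ex: "\<exists>x. x \<in> hom K X Y" if XY: "X \<in> Obj C" "Y \<in> Obj C" "X = Z \<or> Y = Z" for X Y
  proof -
    obtain f where f: "f \<in> hom C X Y"
      using XY Z C.zero_object_homE by metis
    then have "f \<in> FArr J ` Arr K"
      using XY(3) by (intro zero_object_arr_in_range[OF Z]) auto
    then show ?thesis
      using f by auto
  qed
  have unique: "x = y" if "x \<in> hom K X Y" "y \<in> hom K X Y" "X = Z \<or> Y = Z" for X Y x y
  proof -
    have "FArr J x = FArr J y"
      using that by (intro C.zero_object_hom_unique[OF Z]) auto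
    then show ?thesis
      using that by (simp add: FArr_eq_iff)
  qed
  show ?thesis
    unfolding zero_object_def
    using C.zero_object_Obj[OF Z] ex unique by (auto intro!: ex_ex1I simp del: hom_def)
qed

lemma zero_arr_preserve:
  assumes "zero_arr K x"
  shows "zero_arr C (FArr J x)"
proof -
  obtain Z where Z: "zero_object C Z"
    using C.ex_zero_object by blast
  obtain a b where ab: "a \<in> hom K (Dom K x) Z" "b \<in> hom K Z (Cod K x)" "b \<cdot>\<^bsub>K\<^esub> a = x"
    using assms zero_objectI[OF Z] by (rule K.zero_arr_throughE)
  then have "zero_arr C (FArr J b \<cdot>\<^bsub>C\<^esub> FArr J a)"
    by (intro C.zero_arrI[OF Z]) auto
  then show ?thesis
    using ab J.FArr_Comp[of a b] by simp
qed

lemma zero_arr_reflect: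
  assumes "zero_arr C (FArr J x)" and x: "x \<in> Arr K"
  shows "zero_arr K x"
proof -
  obtain Z where Z: "zero_object C Z"
    using C.ex_zero_object by blast
  obtain f g where fg: "f \<in> hom C (Dom K x) Z" "g \<in> hom C Z (Cod K x)" "g \<cdot>\<^bsub>C\<^esub> f = FArr J x"
    using C.zero_arr_throughE[OF assms(1) Z] x by auto
  then obtain a b where ab: "a \<in> Arr K" "FArr J a = f" "b \<in> Arr K" "FArr J b = g"
    using zero_object_arr_in_range[OF Z, of f] zero_object_arr_in_range[OF Z, of g] by auto
  then have ab_hom: "a \<in> hom K (Dom K x) Z" "b \<in> hom K Z (Cod K x)"
    using fg(1,2) by auto
  then have "zero_arr K (b \<cdot>\<^bsub>K\<^esub> a)"
    by (rule K.zero_arrI[OF zero_objectI[OF Z]])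
  moreover have "b \<cdot>\<^bsub>K\<^esub> a = x"
    using ab_hom ab fg(3) x by (subst FArr_eq_iff[symmetric]) auto
  ultimately show ?thesis
    by simp
qed

lemma zero_arr_iff: "x \<in> Arr K \<Longrightarrow> zero_arr K x \<longleftrightarrow> zero_arr C (FArr J x)"
  using zero_arr_preserve zero_arr_reflect by blast

lemma zero_object_iff: "zero_object K Z \<longleftrightarrow> zero_object C Z"
proof
  assume "zero_object K Z"
  then have "Z \<in> Obj C" "zero_arr K (Id K Z)"
    using K.zero_object_Obj[of Z] K.zero_object_iff_zero_arr_Id[of Z] by auto
  then show "zero_object C Z"
    using zero_arr_iff[of "Id K Z"] by (simp add: C.zero_object_iff_zero_arr_Id)
qed (rule zero_objectI)

lemma kernel_of_reflect:
  assumes "kernel_of C (FArr J x) (FArr J y)" "dagger_mono K x" "y \<in> Arr K"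
  shows "kernel_of K x y"
proof -
  have x: "Cod K x = Dom K y"
    using C.kernel_ofD(3)[OF assms(1)] assms(2,3) by simp
  have "zero_arr K (y \<cdot>\<^bsub>K\<^esub> z) \<longleftrightarrow> factors_through K z x"
    if "z \<in> Arr K" "Cod K z = Dom K y" for z
    using C.kernel_of_factors_through_iff[OF assms(1), of "FArr J z"] that assms(2,3) x
    by (simp add: zero_arr_iff factors_through_iff)
  then show ?thesis
    using assms(2,3) x K.dagger_mono_mono_arr by (simp add: K.kernel_of_iff)
qed

lemma ex_lifted_kernel:
  assumes y: "y \<in> Arr K"
  obtains x where "kernel_of K x y" "dagger_mono K x" "kernel_of C (FArr J x) (FArr J y)"
proof -
  obtain k where k: "kernel_of C k (FArr J y)" "dagger_mono C k"
    using C.ex_kernel[of "FArr J y"] y by auto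
  then obtain x where x: "x \<in> Arr K" "FArr J x = k"
    using C.kernel_of_is_kernel by (metis kernelE)
  then have "dagger_mono K x"
    using k(2) by (simp add: dagger_mono_iff)
  then show thesis
    using that[of x] kernel_of_reflect[of x y] k(1) x y by simp
qed

sublocale K: dagger_kernel_category K
proof
  show "\<exists>Z. zero_object K Z"
    using C.ex_zero_object zero_objectI by blast
  show "\<exists>x. kernel_of K x y \<and> dagger_mono K x" if "y \<in> Arr K" for y
    using that by (blast elim: ex_lifted_kernel)
qed

lemma kernel_of_preserve:
  assumes x: "kernel_of K x y"
  shows "kernel_of C (FArr J x) (FArr J y)"
proof -
  obtain w where w: "kernel_of K w y" "kernel_of C (FArr J w) (FArr J y)"
    using ex_lifted_kernel K.kernel_ofD(1)[OF x] by metis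
  obtain \<phi> \<psi> where iso: "inverse_arrows K \<phi> \<psi>" "\<phi> \<in> hom K (Dom K x) (Dom K w)"
    and x_eq: "w \<cdot>\<^bsub>K\<^esub> \<phi> = x"
    using x w(1) by (rule K.kernel_of_isoE)
  have "kernel_of C (FArr J w \<cdot>\<^bsub>C\<^esub> FArr J \<phi>) (FArr J y)"
    using iso K.kernel_ofD(2)[OF w(1)]
    by (intro C.kernel_of_Comp_iso[OF w(2) J.FArr_inverse_arrows[OF iso(1)]]) auto
  then show ?thesis
    using iso(2) K.kernel_ofD(2)[OF w(1)] unfolding x_eq[symmetric] by simp
qed

lemma dagger_kernel_morphism: "dagger_kernel_morphism K C J"
  using K.dagger_kernel_category_axioms C.dagger_kernel_category_axioms J.is_functor
    zero_object_iff C.zero_object_Obj kernel_of_preserve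
  by (simp add: dagger_kernel_morphism_def)

sublocale J: kernel_functor K C J
  by unfold_locales (rule dagger_kernel_morphism)

lemma is_kernel_iff:
  assumes x: "x \<in> Arr K"
  shows "is_kernel K x \<longleftrightarrow> is_kernel C (FArr J x)"
proof
  assume kernel: "is_kernel C (FArr J x)"
  then have dagger_mono: "dagger_mono K x"
    using x by (simp add: dagger_mono_iff)
  have "is_kernel C (perp C (FArr J x))"
    using x by simp
  then obtain y where y: "y \<in> Arr K" "FArr J y = perp C (FArr J x)"
    by (rule kernelE)
  then have "kernel_of C (FArr J x) (FArr J (y\<dagger>\<^bsub>K\<^esub>))"
    using C.is_kernel_kernel_of_perp[OF kernel] by simp
  then have "kernel_of K x (y\<dagger>\<^bsub>K\<^esub>)"
    using dagger_mono y by (intro kernel_of_reflect) simp_all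
  then show "is_kernel K x"
    using dagger_mono by (rule K.kernel_of_is_kernel)
qed (rule J.FArr_is_kernel)

lemma zero_mono_iff:
  assumes "x \<in> Arr K"
  shows "zero_mono K x \<longleftrightarrow> zero_mono C (FArr J x)"
  using assms
proof (rule ex_lifted_kernel)
  fix k assume "kernel_of K k x" "kernel_of C (FArr J k) (FArr J x)"
  then show ?thesis
    using K.kernel_ofD(2)
    by (simp add: K.zero_mono_iff_zero_arr_kernel C.zero_mono_iff_zero_arr_kernel zero_arr_iff)
qed

lemma is_kernelE:
  assumes "is_kernel C k"
  obtains x where "is_kernel K x" "FArr J x = k"
  using assms kernelE is_kernel_iff by metis

lemma ksub_map_in_KSub: "A \<in> KSub K X \<Longrightarrow> ksub_map C J A \<in> KSub C X"
  using J.ksub_map_KSub[of A X] K.KSub_Obj[of A X] by simp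

lemma ex_ksub_map_eq:
  assumes "B \<in> KSub C X"
  obtains A where "A \<in> KSub K X" "ksub_map C J A = B"
  using assms
proof (rule C.KSub_cases)
  fix k assume k: "is_kernel C k" "Cod C k = X" "B = ksub_class C k"
  obtain x where x: "is_kernel K x" "FArr J x = k"
    using k(1) by (rule is_kernelE)
  show thesis
    using k x by (intro that[of "ksub_class K x"]) (auto simp: J.ksub_map_ksub_class)
qed

lemma bij_betw_ksub_map: "bij_betw (ksub_map C J) (KSub K X) (KSub C X)"
proof (rule bij_betw_imageI)
  show "inj_on (ksub_map C J) (KSub K X)"
  proof (rule inj_onI)
    fix A B assume "A \<in> KSub K X" "B \<in> KSub K X" and same: "ksub_map C J A = ksub_map C J B"
    then obtain x y where [simp]: "is_kernel K x" "is_kernel K y" "Cod K x = X" "Cod K y = X"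
      and classes: "A = ksub_class K x" "B = ksub_class K y"
      by (meson K.KSub_cases)
    show "A = B"
      using same unfolding classes
      by (simp add: J.ksub_map_ksub_class C.ksub_class_eq_iff K.ksub_class_eq_iff
          factors_through_iff)
  qed
  show "ksub_map C J ` KSub K X = KSub C X"
    using ksub_map_in_KSub by (blast elim: ex_ksub_map_eq)
qed

lemma order_iso_ksub_map: "order_iso (KSub K X) (ksub_le K) (KSub C X) (ksub_le C) (ksub_map C J)"
  unfolding order_iso_def
proof (intro conjI ballI bij_betw_ksub_map)
  fix A B assume "A \<in> KSub K X" "B \<in> KSub K X"
  then obtain x y where [simp]: "is_kernel K x" "is_kernel K y" "Cod K x = X" "Cod K y = X"
    and classes: "A = ksub_class K x" "B = ksub_class K y"
    by (meson K.KSub_cases)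
  show "ksub_le K A B \<longleftrightarrow> ksub_le C (ksub_map C J A) (ksub_map C J B)"
    unfolding classes
    by (simp add: J.ksub_map_ksub_class K.ksub_le_ksub_class_iff C.ksub_le_ksub_class_iff
        factors_through_iff)
qed

lemma maps_into_ksub_map_iff:
  assumes "A \<in> KSub K (Dom K f)" "B \<in> KSub K (Cod K f)" "f \<in> Arr K"
  shows "maps_into C (FArr J f) (ksub_map C J A) (ksub_map C J B) \<longleftrightarrow> maps_into K f A B"
proof -
  obtain x y where [simp]: "is_kernel K x" "is_kernel K y" "Cod K x = Dom K f" "Cod K y = Cod K f"
    and classes: "A = ksub_class K x" "B = ksub_class K y"
    using assms(1,2) by (meson K.KSub_cases)
  have "factors_through K (f \<cdot>\<^bsub>K\<^esub> x) y \<longleftrightarrow> factors_through C (FArr J f \<cdot>\<^bsub>C\<^esub> FArr J x) (FArr J y)"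
    using assms(3) by (simp add: factors_through_iff)
  then show ?thesis
    using assms(3) unfolding classes
    by (simp add: J.ksub_map_ksub_class K.maps_into_ksub_class_iff C.maps_into_ksub_class_iff)
qed

lemma bij_betw_Obj_kernel_fibration:
  "bij_betw (\<lambda>a. (FObj kernel_fibration_proj a, FObj (kernel_fibration_map C J) a))
    (Obj (kernel_fibration K))
    {(X, b). X \<in> Obj K \<and> b \<in> Obj (kernel_fibration C) \<and> FObj J X = FObj kernel_fibration_proj b}"
  (is "bij_betw ?f _ ?fibre_product")
proof (intro bij_betw_imageI equalityI)
  show "inj_on ?f (Obj (kernel_fibration K))"
    by (intro inj_onI) (auto simp: K.kernel_fibration_simps fibration_functor_simps
        dest: inj_onD[OF bij_betw_imp_inj_on[OF bij_betw_ksub_map]])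
  show "?f ` Obj (kernel_fibration K) \<subseteq> ?fibre_product"
    using ksub_map_in_KSub K.KSub_Obj
    by (auto simp: K.kernel_fibration_simps C.kernel_fibration_simps fibration_functor_simps)
  show "?fibre_product \<subseteq> ?f ` Obj (kernel_fibration K)"
  proof
    fix t assume "t \<in> ?fibre_product"
    then obtain X B where t: "t = (X, (X, B))" "B \<in> KSub C X"
      by (auto simp: C.kernel_fibration_simps fibration_functor_simps)
    obtain A where "A \<in> KSub K X" "ksub_map C J A = B"
      using t(2) by (rule ex_ksub_map_eq)
    then show "t \<in> ?f ` Obj (kernel_fibration K)"
      using t K.KSub_Obj by (intro image_eqI[of _ _ "(X, A)"])
        (auto simp: K.kernel_fibration_simps fibration_functor_simps)
  qed
qed

lemma bij_betw_Arr_kernel_fibration: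
  "bij_betw (\<lambda>t. (FArr kernel_fibration_proj t, FArr (kernel_fibration_map C J) t))
    (Arr (kernel_fibration K))
    {(f, u). f \<in> Arr K \<and> u \<in> Arr (kernel_fibration C) \<and> FArr J f = FArr kernel_fibration_proj u}"
  (is "bij_betw ?f _ ?fibre_product")
proof (intro bij_betw_imageI equalityI)
  show "inj_on ?f (Arr (kernel_fibration K))"
    by (intro inj_onI) (auto simp: K.kernel_fibration_simps fibration_functor_simps
        dest: inj_onD[OF bij_betw_imp_inj_on[OF bij_betw_ksub_map]])
  show "?f ` Arr (kernel_fibration K) \<subseteq> ?fibre_product"
    using ksub_map_in_KSub maps_into_ksub_map_iff
    by (auto simp: K.kernel_fibration_simps C.kernel_fibration_simps fibration_functor_simps)
  show "?fibre_product \<subseteq> ?f ` Arr (kernel_fibration K)"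
  proof
    fix t assume "t \<in> ?fibre_product"
    then obtain f A' B' where f: "f \<in> Arr K"
      and t: "t = (f, ((Dom K f, A'), FArr J f, (Cod K f, B')))"
      and A': "A' \<in> KSub C (Dom K f)" and B': "B' \<in> KSub C (Cod K f)"
      and maps_into: "maps_into C (FArr J f) A' B'"
      by (auto simp: C.kernel_fibration_simps fibration_functor_simps)
    obtain A where "A \<in> KSub K (Dom K f)" "ksub_map C J A = A'"
      using A' by (rule ex_ksub_map_eq)
    moreover obtain B where "B \<in> KSub K (Cod K f)" "ksub_map C J B = B'"
      using B' by (rule ex_ksub_map_eq)
    ultimately show "t \<in> ?f ` Arr (kernel_fibration K)"
      using t f maps_into maps_into_ksub_map_iff[of A f B]
      by (intro image_eqI[of _ _ "((Dom K f, A), f, (Cod K f, B))"])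
        (auto simp: K.kernel_fibration_simps fibration_functor_simps)
  qed
qed

lemma cat_pullback_square_kernel_fibration:
  "cat_pullback_square (kernel_fibration K) K (kernel_fibration C) C
     kernel_fibration_proj (kernel_fibration_map C J) J kernel_fibration_proj"
  unfolding cat_pullback_square_def
proof (intro conjI)
  show "functor_eq (kernel_fibration K) (functor_comp J kernel_fibration_proj)
      (functor_comp kernel_fibration_proj (kernel_fibration_map C J))"
    unfolding functor_eq_def functor_comp_def
    by (auto simp: K.kernel_fibration_simps fibration_functor_simps)
qed (rule K.is_functor_kernel_fibration_proj C.is_functor_kernel_fibration_proj
    J.is_functor_kernel_fibration_map J.is_functor
    bij_betw_Obj_kernel_fibration bij_betw_Arr_kernel_fibration)+

lemma boolean_dagger_kernel_category:
  assumes "boolean_dagger_kernel_category C"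
  shows "boolean_dagger_kernel_category K"
proof
  fix x y r s
  assume [simp]: "is_kernel K x" "is_kernel K y" "Cod K x = Cod K y"
    and pb: "is_pullback K x y r s" and zero: "zero_arr K (x \<cdot>\<^bsub>K\<^esub> r)"
  obtain p q where "is_pullback C (FArr J x) (FArr J y) p q" "is_kernel C p" "is_kernel C q"
    using C.ex_pullback_of_kernels[of "FArr J x" "FArr J y"] by auto
  then obtain a b where [simp]: "a \<in> Arr K" "b \<in> Arr K"
    and pb_C: "is_pullback C (FArr J x) (FArr J y) (FArr J a) (FArr J b)"
    using kernelE by metis
  then have [simp]: "Cod K a = Dom K x" "Cod K b = Dom K y"
    and "FArr J x \<cdot>\<^bsub>C\<^esub> FArr J a = FArr J y \<cdot>\<^bsub>C\<^esub> FArr J b"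
    by (auto simp: is_pullback_def)
  then have square: "x \<cdot>\<^bsub>K\<^esub> a = y \<cdot>\<^bsub>K\<^esub> b"
    by (subst FArr_eq_iff[symmetric]) simp_all
  have "factors_through K (x \<cdot>\<^bsub>K\<^esub> a) x" "factors_through K (x \<cdot>\<^bsub>K\<^esub> a) y"
    using K.factors_throughI[of x a] K.factors_throughI[of y b] square by simp_all
  then have "zero_arr K (x \<cdot>\<^bsub>K\<^esub> a)"
    using K.is_pullback_factors_through[OF pb] zero K.zero_arr_factors_through by blast
  then have "zero_arr C (FArr J x \<cdot>\<^bsub>C\<^esub> FArr J a)"
    by (simp add: zero_arr_iff)
  then have "zero_arr C ((FArr J x)\<dagger>\<^bsub>C\<^esub> \<cdot>\<^bsub>C\<^esub> FArr J y)"
    using boolean_dagger_kernel_category.boolean[OF assms _ _ _ pb_C] by simp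
  then show "zero_arr K (x\<dagger>\<^bsub>K\<^esub> \<cdot>\<^bsub>K\<^esub> y)"
    by (simp add: zero_arr_iff)
qed

end

section \<open>The category of cokernel-kernel pairs\<close>

lemma Obj_kck [simp]: "Obj (kck C) = Obj C"
  by (simp add: kck_def)

lemma FObj_kck_functor [simp]: "FObj (kck_functor C) X = X"
  by (simp add: kck_functor_def)

context dagger_kernel_category
begin

lemma kck_factorisableE:
  assumes "kck_factorisable C f"
  obtains c k where "(c, k) \<in> kck_factorisations C f"
  using assms by (auto simp: kck_factorisable_def)

lemma kck_factorisationsD:
  assumes "(c, k) \<in> kck_factorisations C f"
  shows "kck_pair C c k" "k \<cdot> c = f" "Dom C c = Dom C f" "Cod C k = Cod C f" "f \<in> Arr C"
  using assms kck_pairD[of c k] by (auto simp: kck_factorisations_def)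

lemma kck_factorisable_Arr: "kck_factorisable C f \<Longrightarrow> f \<in> Arr C"
  using kck_factorisationsD(5) by (blast elim: kck_factorisableE)

lemma Arr_kck: "Arr (kck C) = kck_factorisations C ` {f. kck_factorisable C f}"
proof -
  have "Arr (kck C) = {kck_factorisations C (k \<cdot> c) | c k. kck_pair C c k}"
    using kck_class_eq_kck_factorisations by (auto simp: kck_def) blast+
  then show ?thesis
    by (auto simp: kck_factorisable_iff)
qed

lemma the_elem_image_kck_factorisations:
  assumes "kck_factorisable C f" "\<And>c k. (c, k) \<in> kck_factorisations C f \<Longrightarrow> h c k = y"
  shows "the_elem ((\<lambda>(c, k). h c k) ` kck_factorisations C f) = y"
proof -
  have "(\<lambda>(c, k). h c k) ` kck_factorisations C f = {y}"
    using assms by (force elim: kck_factorisableE)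
  then show ?thesis
    by simp
qed

lemma kck_factorisations_simps [simp]:
  assumes "kck_factorisable C f"
  shows "kck_factorisations C f \<in> Arr (kck C)"
    and "Dom (kck C) (kck_factorisations C f) = Dom C f"
    and "Cod (kck C) (kck_factorisations C f) = Cod C f"
    and "FArr (kck_functor C) (kck_factorisations C f) = f"
proof -
  show "kck_factorisations C f \<in> Arr (kck C)"
    using assms by (simp add: Arr_kck)
qed (use assms kck_factorisationsD in
    \<open>simp_all add: kck_def kck_functor_def the_elem_image_kck_factorisations\<close>)

lemma kck_factorisations_Dag:
  assumes "(c, k) \<in> kck_factorisations C f"
  shows "(k\<dagger>, c\<dagger>) \<in> kck_factorisations C (f\<dagger>)"
proof -
  note ck = kck_factorisationsD[OF assms]
  note [simp] = kck_pairD[OF ck(1)]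
  have "kck_pair C (k\<dagger>) (c\<dagger>)"
    by (intro kck_pairI) simp_all
  moreover have "c\<dagger> \<cdot> k\<dagger> = f\<dagger>"
    unfolding ck(2)[symmetric] by simp
  ultimately show ?thesis
    by (simp add: kck_factorisations_def)
qed

lemma kck_factorisable_Dag:
  assumes "kck_factorisable C f"
  shows "kck_factorisable C (f\<dagger>)"
  using assms kck_factorisations_Dag by (auto simp: kck_factorisable_def)

lemma Dag_kck:
  assumes "kck_factorisable C f"
  shows "(kck_factorisations C f)\<dagger>\<^bsub>kck C\<^esub> = kck_factorisations C (f\<dagger>)"
proof -
  have f: "f \<in> Arr C"
    using assms by (rule kck_factorisable_Arr)
  have "(c, k) \<in> (\<lambda>(c, k). (k\<dagger>, c\<dagger>)) ` kck_factorisations C f"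
    if ck: "(c, k) \<in> kck_factorisations C (f\<dagger>)" for c k
    using kck_factorisations_Dag[OF ck] kck_pairD[OF kck_factorisationsD(1)[OF ck]] f
    by (intro image_eqI[of _ _ "(k\<dagger>, c\<dagger>)"]) auto
  then have "(\<lambda>(c, k). (k\<dagger>, c\<dagger>)) ` kck_factorisations C f = kck_factorisations C (f\<dagger>)"
    using kck_factorisations_Dag by auto
  then show ?thesis
    by (simp add: kck_def)
qed

lemma Id_kck:
  assumes [simp]: "X \<in> Obj C"
  shows "Id (kck C) X = kck_factorisations C (Id C X)"
proof -
  have "kck_pair C (Id C X) (Id C X)"
    by (intro kck_pairI) (simp_all add: Id_is_kernel)
  then show ?thesis
    using kck_class_eq_kck_factorisations by (simp add: kck_def)
qed

end

context boolean_dagger_kernel_category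
begin

lemma kck_composite_factorisation:
  assumes ck: "(c, k) \<in> kck_factorisations C f" and dl: "(d, l) \<in> kck_factorisations C g"
    and pb: "is_pullback C k (d\<dagger>) q p" and p: "is_kernel C p" and q: "is_kernel C q"
  shows "(q\<dagger> \<cdot> c, l \<cdot> p) \<in> kck_factorisations C (g \<cdot> f)"
proof -
  note ckD = kck_factorisationsD[OF ck] and dlD = kck_factorisationsD[OF dl]
  note [simp] = kck_pairD[OF ckD(1)] kck_pairD[OF dlD(1)] p q
  have [simp]: "Cod C q = Dom C k" "Cod C p = Dom C l" "Dom C p = Dom C q" "Dom C d = Cod C k"
    using pb by (auto simp: is_pullback_def)
  have "is_kernel C (l \<cdot> p)" "is_kernel C (c\<dagger> \<cdot> q)"
    by (auto intro: is_kernel_Comp)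
  then have "kck_pair C (q\<dagger> \<cdot> c) (l \<cdot> p)"
    by (intro kck_pairI) simp_all
  moreover have "(l \<cdot> p) \<cdot> (q\<dagger> \<cdot> c) = g \<cdot> f"
  proof -
    have "(k\<dagger> \<cdot> d\<dagger>)\<dagger> = (q \<cdot> p\<dagger>)\<dagger>"
      using Dag_Comp_kernels_pullback[OF _ _ pb p] by simp
    then have dk: "d \<cdot> k = p \<cdot> q\<dagger>"
      by simp
    have "(l \<cdot> p) \<cdot> (q\<dagger> \<cdot> c) = l \<cdot> ((p \<cdot> q\<dagger>) \<cdot> c)"
      by simp
    also have "\<dots> = (l \<cdot> d) \<cdot> (k \<cdot> c)"
      unfolding dk[symmetric] by simp
    finally show ?thesis
      unfolding ckD(2) dlD(2) .
  qed
  ultimately show ?thesis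
    by (simp add: kck_factorisations_def)
qed

lemma ex_kck_composite:
  assumes f: "kck_factorisable C f" and g: "kck_factorisable C g" and fg: "Dom C g = Cod C f"
  obtains c k d l p q where "(c, k) \<in> kck_factorisations C f" "(d, l) \<in> kck_factorisations C g"
    "is_pullback C k (d\<dagger>) q p" "is_kernel C p" "is_kernel C q"
proof -
  obtain c k d l where ck: "(c, k) \<in> kck_factorisations C f"
    and dl: "(d, l) \<in> kck_factorisations C g"
    using f g by (metis kck_factorisableE)
  note ckD = kck_factorisationsD[OF ck] and dlD = kck_factorisationsD[OF dl]
  have "Cod C k = Cod C (d\<dagger>)"
    using ckD(4) dlD(3) fg kck_pairD(1)[OF dlD(1)] by simp
  then show thesis
    using ex_pullback_of_kernels[OF kck_pairD(3)[OF ckD(1)] kck_pairD(2)[OF dlD(1)]] that ck dl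
    by metis
qed

lemma kck_factorisable_Comp:
  assumes "kck_factorisable C f" "kck_factorisable C g" "Dom C g = Cod C f"
  shows "kck_factorisable C (g \<cdot> f)"
  using ex_kck_composite[OF assms] kck_composite_factorisation unfolding kck_factorisable_def
  by (metis empty_iff)

lemma Comp_kck:
  assumes "kck_factorisable C f" "kck_factorisable C g" "Dom C g = Cod C f"
  shows "kck_factorisations C g \<cdot>\<^bsub>kck C\<^esub> kck_factorisations C f = kck_factorisations C (g \<cdot> f)"
proof -
  have same: "kck_class C (q\<dagger> \<cdot> c) (l \<cdot> p) = kck_factorisations C (g \<cdot> f)"
    if "(c, k) \<in> kck_factorisations C f" "(d, l) \<in> kck_factorisations C g"
      "is_pullback C k (d\<dagger>) q p" "is_kernel C p" "is_kernel C q" for c k d l p q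
    using kck_factorisationsD(1,2)[OF kck_composite_factorisation[OF that]]
      kck_class_eq_kck_factorisations by simp
  let ?composites = "{kck_class C (q\<dagger> \<cdot> c) (l \<cdot> p) | c k d l p q.
      (c, k) \<in> kck_factorisations C f \<and> (d, l) \<in> kck_factorisations C g
        \<and> is_pullback C k (d\<dagger>) q p \<and> is_kernel C p \<and> is_kernel C q}"
  obtain c k d l p q where composable: "(c, k) \<in> kck_factorisations C f"
    "(d, l) \<in> kck_factorisations C g" "is_pullback C k (d\<dagger>) q p" "is_kernel C p" "is_kernel C q"
    using ex_kck_composite[OF assms] .
  then have "kck_class C (q\<dagger> \<cdot> c) (l \<cdot> p) \<in> ?composites"
    by blast
  then have "kck_factorisations C (g \<cdot> f) \<in> ?composites"
    unfolding same[OF composable] .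
  moreover have "S = kck_factorisations C (g \<cdot> f)" if "S \<in> ?composites" for S
    using that same by blast
  ultimately have "?composites = {kck_factorisations C (g \<cdot> f)}"
    by blast
  then show ?thesis
    by (simp add: kck_def)
qed

sublocale kck: wide_kernel_embedding "kck C" C "kck_functor C"
proof
  show "inj_on (FArr (kck_functor C)) (Arr (kck C))"
    by (auto simp: Arr_kck intro!: inj_onI)
  show "k \<in> FArr (kck_functor C) ` Arr (kck C)" if "is_kernel C k" for k
    using is_kernel_kck_factorisable[OF that]
    by (intro image_eqI[of _ _ "kck_factorisations C k"]) auto
next
  fix X assume "X \<in> Obj C"
  then show "Id (kck C) X \<in> Arr (kck C) \<and> FArr (kck_functor C) (Id (kck C) X) = Id C X"
    by (simp add: Id_kck Id_is_kernel is_kernel_kck_factorisable)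
next
  fix S assume "S \<in> Arr (kck C)"
  then show "FArr (kck_functor C) S \<in> hom C (Dom (kck C) S) (Cod (kck C) S)"
    and "S\<dagger>\<^bsub>kck C\<^esub> \<in> Arr (kck C) \<and> FArr (kck_functor C) (S\<dagger>\<^bsub>kck C\<^esub>) = (FArr (kck_functor C) S)\<dagger>"
    by (auto simp: Arr_kck Dag_kck kck_factorisable_Dag kck_factorisable_Arr)
next
  fix S T assume "S \<in> Arr (kck C)" "T \<in> Arr (kck C)" "Dom (kck C) T = Cod (kck C) S"
  then show "T \<cdot>\<^bsub>kck C\<^esub> S \<in> Arr (kck C)
      \<and> FArr (kck_functor C) (T \<cdot>\<^bsub>kck C\<^esub> S) = FArr (kck_functor C) T \<cdot> FArr (kck_functor C) S"
    by (auto simp: Arr_kck Comp_kck kck_factorisable_Comp)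
qed simp_all

lemma kck_zero_mono_is_kernel:
  assumes "zero_mono (kck C) x"
  shows "is_kernel (kck C) x"
proof -
  have x: "x \<in> Arr (kck C)"
    using assms by (simp add: zero_mono_def)
  then obtain f where f: "kck_factorisable C f" "x = kck_factorisations C f"
    by (auto simp: Arr_kck)
  then have "is_kernel C f"
    using assms x kck.zero_mono_iff[OF x] by (intro zero_mono_kck_factorisable_is_kernel) simp_all
  then show ?thesis
    using f x kck.is_kernel_iff[OF x] by simp
qed

lemma kck_universal:
  assumes "\<And>m. zero_mono E m \<Longrightarrow> is_kernel E m" and F: "dagger_kernel_morphism E C F"
  shows "\<exists>G. is_functor E (kck C) G \<and> functor_eq E (functor_comp (kck_functor C) G) F
    \<and> (\<forall>G'. is_functor E (kck C) G' \<and> functor_eq E (functor_comp (kck_functor C) G') F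
        \<longrightarrow> functor_eq E G' G)"
proof -
  interpret F: kernel_functor E C F
    by unfold_locales (rule F)
  have "kck_factorisable C (FArr F f)" if "f \<in> Arr E" for f
    using assms(1) that by (intro F.FArr_kck_factorisable F.C.zero_monos_kernels_kck_factorisable)
  then have "FArr F ` Arr E \<subseteq> FArr (kck_functor C) ` Arr (kck C)"
    by (force simp: Arr_kck image_image)
  with F.is_functor show ?thesis
    by (rule kck.ex_unique_lift)
qed

end

theorem theorem6p6:
  fixes D :: "('o, 'a) dagger_cat"
  assumes "boolean_dagger_kernel_category D"
  shows "boolean_dagger_kernel_category (kck D)
    \<and> dagger_kernel_morphism (kck D) D (kck_functor D)
    \<and> (\<forall>X \<in> Obj (kck D). order_iso (KSub (kck D) X) (ksub_le (kck D))
         (KSub D (FObj (kck_functor D) X)) (ksub_le D) (ksub_map D (kck_functor D)))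
    \<and> cat_pullback_square (kernel_fibration (kck D)) (kck D) (kernel_fibration D) D
         kernel_fibration_proj (kernel_fibration_map D (kck_functor D))
         (kck_functor D) kernel_fibration_proj
    \<and> {m. is_kernel (kck D) m} = {m. dagger_mono (kck D) m}
    \<and> {m. dagger_mono (kck D) m} = {m. mono_arr (kck D) m}
    \<and> {m. mono_arr (kck D) m} = {m. zero_mono (kck D) m}
    \<and> (\<forall>(E :: ('p, 'b) dagger_cat) F.
         boolean_dagger_kernel_category E \<and> (\<forall>m. zero_mono E m \<longrightarrow> is_kernel E m)
           \<and> dagger_kernel_morphism E D F
         \<longrightarrow> (\<exists>G. is_functor E (kck D) G \<and> functor_eq E (functor_comp (kck_functor D) G) F
               \<and> (\<forall>G'. is_functor E (kck D) G'
                     \<and> functor_eq E (functor_comp (kck_functor D) G') F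
                   \<longrightarrow> functor_eq E G' G)))"
proof -
  interpret D: boolean_dagger_kernel_category D
    by (rule assms)
  have order_iso: "order_iso (KSub (kck D) X) (ksub_le (kck D))
      (KSub D (FObj (kck_functor D) X)) (ksub_le D) (ksub_map D (kck_functor D))" for X
    using D.kck.order_iso_ksub_map by simp
  show ?thesis
    by (intro conjI ballI allI impI D.kck.boolean_dagger_kernel_category[OF assms]
        D.kck.dagger_kernel_morphism order_iso D.kck.cat_pullback_square_kernel_fibration
        D.kck.K.mono_classes_coincide D.kck_zero_mono_is_kernel D.kck_universal) simp_all
qed

end
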